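(* There exist hyperbolic, free-by-cyclic groups which have infinitely many epimorphisms onto $\mathbb{Z}$ and, furthermore, such that each of these groups $G$ is isomorphic to a semidirect product $F_n\rtimes\mathbb{Z}$ for infinitely many positive integers $n$.
   Context: Hyperbolic means word-hyperbolic in the sense of Gromov. $F_n$ denotes the free group of rank $n$. A group is free-by-cyclic if it is isomorphic to $F_n\rtimes\mathbb{Z}$ for some finite $n$ (and some action of $\mathbb{Z}$ on $F_n$ by automorphisms). When a group is said to be isomorphic to $F_n\rtimes\mathbb{Z}$ for infinitely many $n$, the action of $\mathbb{Z}$ may depend on $n$. *)

theory Defs
  imports "HOL-Algebra.Algebra"
begin

section \<open>Free groups\<close>

text \<open>
  A letter \<open>(b, x)\<close> stands for the generator \<open>x\<close> if \<open>b\<close> holds and for its formal inverse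
  otherwise. The free group on \<open>S\<close> is realised as the set of reduced words over \<open>S\<close>, multiplied by
  concatenation followed by free reduction.
\<close>

type_synonym 'a letter = "bool \<times> 'a"

definition inv_letter :: "'a letter \<Rightarrow> 'a letter" where
  "inv_letter l = (\<not> fst l, snd l)"

definition reduced :: "'a letter list \<Rightarrow> bool" where
  "reduced = successively (\<lambda>k l. l \<noteq> inv_letter k)"

definition cons_letter :: "'a letter \<Rightarrow> 'a letter list \<Rightarrow> 'a letter list" where
  "cons_letter l w =
     (case w of [] \<Rightarrow> [l] | k # v \<Rightarrow> if k = inv_letter l then v else l # w)"

definition free_group :: "'a set \<Rightarrow> 'a letter list monoid" where
  "free_group S =
     \<lparr>carrier = {w. reduced w \<and> snd ` set w \<subseteq> S},
      monoid.mult = (\<lambda>u v. foldr cons_letter u v),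
      one = []\<rparr>"

lemma cons_letter_Nil [simp]: "cons_letter l [] = [l]"
  by (simp add: cons_letter_def)

lemma cons_letter_Cons:
  "cons_letter l (k # v) = (if k = inv_letter l then v else l # k # v)"
  by (simp add: cons_letter_def)

lemma inv_letter_inv_letter [simp]: "inv_letter (inv_letter l) = l"
  by (simp add: inv_letter_def)

lemma inv_letter_neq [simp]: "inv_letter l \<noteq> l" "l \<noteq> inv_letter l"
  by (auto simp: inv_letter_def prod_eq_iff)

lemma snd_inv_letter [simp]: "snd (inv_letter l) = snd l"
  by (simp add: inv_letter_def)

lemma reduced_Nil [simp]: "reduced []"
  by (simp add: reduced_def)

lemma reduced_Cons:
  "reduced (l # w) \<longleftrightarrow> reduced w \<and> (case w of [] \<Rightarrow> True | k # v \<Rightarrow> k \<noteq> inv_letter l)"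
  by (cases w) (auto simp: reduced_def)

lemma reduced_cons_letter: "reduced w \<Longrightarrow> reduced (cons_letter l w)"
  by (cases w) (auto simp: cons_letter_Cons reduced_Cons)

lemma letters_cons_letter: "snd ` set (cons_letter l w) \<subseteq> insert (snd l) (snd ` set w)"
  by (cases w) (auto simp: cons_letter_Cons)

lemma cons_letter_cancel:
  "reduced w \<Longrightarrow> cons_letter l (cons_letter (inv_letter l) w) = w"
proof (cases w)
  case (Cons k v)
  assume "reduced w"
  then show ?thesis
    by (cases v) (auto simp: Cons cons_letter_Cons reduced_Cons)
qed (simp add: cons_letter_Cons)

lemma reduced_foldr_cons: "reduced w \<Longrightarrow> reduced (foldr cons_letter u w)"
  by (induction u) (auto simp: reduced_cons_letter)

lemma letters_foldr_cons:
  "snd ` set (foldr cons_letter u w) \<subseteq> snd ` set u \<union> snd ` set w"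
proof (induction u)
  case (Cons l u)
  then show ?case using letters_cons_letter[of l "foldr cons_letter u w"]
    unfolding foldr.simps comp_apply list.set image_insert by blast
qed simp

lemma foldr_cons_letter:
  assumes "reduced w"
  shows "foldr cons_letter (cons_letter l u) w = cons_letter l (foldr cons_letter u w)"
proof (cases u)
  case (Cons k v)
  have "reduced (foldr cons_letter v w)"
    using assms by (rule reduced_foldr_cons)
  then have "cons_letter l (cons_letter (inv_letter l) (foldr cons_letter v w)) = foldr cons_letter v w"
    by (rule cons_letter_cancel)
  then show ?thesis
    by (cases "k = inv_letter l") (simp_all add: Cons cons_letter_Cons)
qed simp

lemma foldr_cons_assoc:
  assumes "reduced w"
  shows "foldr cons_letter (foldr cons_letter u v) w = foldr cons_letter u (foldr cons_letter v w)"
  by (induction u) (auto simp: foldr_cons_letter assms)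

lemma foldr_cons_Nil: "reduced w \<Longrightarrow> foldr cons_letter w [] = w"
proof (induction w)
  case (Cons l w)
  then have "foldr cons_letter w [] = w"
    by (simp add: reduced_Cons)
  then show ?case
    using Cons.prems by (cases w) (auto simp: reduced_Cons cons_letter_Cons)
qed simp

lemma foldr_cons_inverse:
  "reduced w \<Longrightarrow> foldr cons_letter (rev (map inv_letter u)) (foldr cons_letter u w) = w"
proof (induction u arbitrary: w)
  case (Cons l u)
  then show ?case
    using cons_letter_cancel[of "foldr cons_letter u w" "inv_letter l"]
    by (simp add: reduced_foldr_cons)
qed simp

lemma group_free_group: "group (free_group S)"
proof (rule groupI)
  fix u assume u: "u \<in> carrier (free_group S)"
  let ?v = "foldr cons_letter (rev (map inv_letter u)) []"
  have "?v \<in> carrier (free_group S)"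
    using u letters_foldr_cons[of "rev (map inv_letter u)" "[]"]
    by (force simp: free_group_def reduced_foldr_cons image_image)
  moreover have "?v \<otimes>\<^bsub>free_group S\<^esub> u = \<one>\<^bsub>free_group S\<^esub>"
    using u foldr_cons_inverse[of "[]" u] foldr_cons_Nil[of u]
      foldr_cons_assoc[of u "rev (map inv_letter u)" "[]"]
    by (simp add: free_group_def)
  ultimately show "\<exists>v\<in>carrier (free_group S). v \<otimes>\<^bsub>free_group S\<^esub> u = \<one>\<^bsub>free_group S\<^esub>"
    by blast
next
  fix u v assume "u \<in> carrier (free_group S)" "v \<in> carrier (free_group S)"
  then show "u \<otimes>\<^bsub>free_group S\<^esub> v \<in> carrier (free_group S)"
    using letters_foldr_cons[of u v]
    by (simp add: free_group_def reduced_foldr_cons) (meson Un_least subset_trans)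
qed (auto simp: free_group_def foldr_cons_assoc)


section \<open>Semidirect products and free-by-cyclic groups\<close>

definition semidirect_product ::
  "('a, 'c) monoid_scheme \<Rightarrow> ('b, 'd) monoid_scheme \<Rightarrow> ('b \<Rightarrow> 'a \<Rightarrow> 'a) \<Rightarrow> ('a \<times> 'b) monoid" where
  "semidirect_product N H \<phi> =
     \<lparr>carrier = carrier N \<times> carrier H,
      monoid.mult = (\<lambda>(a, h) (b, k). (a \<otimes>\<^bsub>N\<^esub> \<phi> h b, h \<otimes>\<^bsub>H\<^esub> k)),
      one = (\<one>\<^bsub>N\<^esub>, \<one>\<^bsub>H\<^esub>)\<rparr>"

lemma group_semidirect_product:
  assumes N: "group N" and H: "group H" and \<phi>: "\<phi> \<in> hom H (AutoGroup N)"
  shows "group (semidirect_product N H \<phi>)"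
proof -
  interpret N: group N by (rule N)
  interpret H: group H by (rule H)
  interpret A: group "AutoGroup N" by (rule N.AutoGroup)
  have aut: "\<phi> h \<in> hom N N" "\<phi> h \<in> Bij (carrier N)" if "h \<in> carrier H" for h
    using hom_in_carrier[OF \<phi> that] by (auto simp: AutoGroup_def auto_def)
  have closed [simp]: "\<phi> h a \<in> carrier N" if "h \<in> carrier H" "a \<in> carrier N" for h a
    using aut(1)[OF that(1)] that(2) by (rule hom_in_carrier)
  have mult: "\<phi> h (a \<otimes>\<^bsub>N\<^esub> b) = \<phi> h a \<otimes>\<^bsub>N\<^esub> \<phi> h b"
    if "h \<in> carrier H" "a \<in> carrier N" "b \<in> carrier N" for h a b
    using aut(1)[OF that(1)] that(2,3) by (rule hom_mult)
  have comp: "\<phi> (h \<otimes>\<^bsub>H\<^esub> k) a = \<phi> h (\<phi> k a)"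
    if "h \<in> carrier H" "k \<in> carrier H" "a \<in> carrier N" for h k a
    using hom_mult[OF \<phi> that(1,2)] that aut(2)
    by (simp add: AutoGroup_def BijGroup_def compose_def)
  have "\<phi> \<one>\<^bsub>H\<^esub> = \<one>\<^bsub>AutoGroup N\<^esub>"
    using hom_one[OF \<phi> H N.AutoGroup] .
  then have one: "\<phi> \<one>\<^bsub>H\<^esub> a = a" if "a \<in> carrier N" for a
    using that by (simp add: AutoGroup_def BijGroup_def)
  show ?thesis
  proof (rule groupI)
    fix x assume "x \<in> carrier (semidirect_product N H \<phi>)"
    then obtain a h where x: "x = (a, h)" "a \<in> carrier N" "h \<in> carrier H"
      by (auto simp: semidirect_product_def)
    have "\<phi> (inv\<^bsub>H\<^esub> h) (inv\<^bsub>N\<^esub> a) \<otimes>\<^bsub>N\<^esub> \<phi> (inv\<^bsub>H\<^esub> h) a = \<phi> (inv\<^bsub>H\<^esub> h) \<one>\<^bsub>N\<^esub>"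
      using x by (simp flip: mult)
    also have "\<dots> = \<one>\<^bsub>N\<^esub>"
      using hom_one[OF aut(1) N N] x by simp
    finally show "\<exists>y\<in>carrier (semidirect_product N H \<phi>).
        y \<otimes>\<^bsub>semidirect_product N H \<phi>\<^esub> x = \<one>\<^bsub>semidirect_product N H \<phi>\<^esub>"
      using x by (intro bexI[of _ "(\<phi> (inv\<^bsub>H\<^esub> h) (inv\<^bsub>N\<^esub> a), inv\<^bsub>H\<^esub> h)"])
        (auto simp: semidirect_product_def)
  qed (auto simp: semidirect_product_def one mult comp N.m_assoc H.m_assoc)
qed

definition is_free_by_Z :: "('a, 'c) monoid_scheme \<Rightarrow> nat \<Rightarrow> bool" where
  "is_free_by_Z G n \<longleftrightarrow>
     (\<exists>\<phi> \<in> hom integer_group (AutoGroup (free_group {..<n})).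
        G \<cong> semidirect_product (free_group {..<n}) integer_group \<phi>)"

definition free_by_cyclic :: "('a, 'c) monoid_scheme \<Rightarrow> bool" where
  "free_by_cyclic G \<longleftrightarrow> (\<exists>n. is_free_by_Z G n)"


section \<open>Word-hyperbolic groups\<close>

definition word_length :: "('a, 'c) monoid_scheme \<Rightarrow> 'a set \<Rightarrow> 'a \<Rightarrow> nat" where
  "word_length G S g =
     (LEAST n. \<exists>ws. length ws = n \<and> set ws \<subseteq> S \<union> m_inv G ` S \<and> foldr (monoid.mult G) ws \<one>\<^bsub>G\<^esub> = g)"

definition word_dist :: "('a, 'c) monoid_scheme \<Rightarrow> 'a set \<Rightarrow> 'a \<Rightarrow> 'a \<Rightarrow> real" where
  "word_dist G S g h = real (word_length G S (inv\<^bsub>G\<^esub> g \<otimes>\<^bsub>G\<^esub> h))"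

definition gromov_product :: "('a \<Rightarrow> 'a \<Rightarrow> real) \<Rightarrow> 'a \<Rightarrow> 'a \<Rightarrow> 'a \<Rightarrow> real" where
  "gromov_product d w x y = (d x w + d y w - d x y) / 2"

definition gromov_hyperbolic_on :: "'a set \<Rightarrow> ('a \<Rightarrow> 'a \<Rightarrow> real) \<Rightarrow> bool" where
  "gromov_hyperbolic_on S d \<longleftrightarrow>
     (\<exists>\<delta>\<ge>0. \<forall>w\<in>S. \<forall>x\<in>S. \<forall>y\<in>S. \<forall>z\<in>S.
        gromov_product d w x z \<ge> min (gromov_product d w x y) (gromov_product d w y z) - \<delta>)"

text \<open>
  Hyperbolicity of the word metric does not depend on the chosen finite generating set, so the
  definition asks for one such set, as usual.
\<close>

definition hyperbolic_group :: "('a, 'c) monoid_scheme \<Rightarrow> bool" where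
  "hyperbolic_group G \<longleftrightarrow>
     group G \<and>
     (\<exists>S. finite S \<and> S \<subseteq> carrier G \<and> generate G S = carrier G \<and>
        gromov_hyperbolic_on (carrier G) (word_dist G S))"


section \<open>Epimorphisms\<close>

text \<open>
  Members of \<open>epi G H\<close> are unconstrained outside \<open>carrier G\<close>; restricting to extensional functions
  makes distinct functions correspond to distinct epimorphisms, so that they can be counted.
\<close>

definition epimorphisms :: "('a, 'c) monoid_scheme \<Rightarrow> ('b, 'd) monoid_scheme \<Rightarrow> ('a \<Rightarrow> 'b) set" where
  "epimorphisms G H = epi G H \<inter> extensional (carrier G)"

end

theory Submission
  imports Defs
begin

text \<open>
  Let \<open>G = \<langle>x, y, t | y t = t x, x y x x t = t y x y y\<rangle>\<close>. With the rungs \<open>s\<^sub>0 = t\<close>, \<open>s\<^sub>1 = x\<^sup>-\<^sup>1 s\<^sub>0 y\<close>,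
  \<open>s\<^sub>2 = y\<^sup>-\<^sup>1 s\<^sub>1 x\<close>, \<open>s\<^sub>3 = x\<^sup>-\<^sup>1 s\<^sub>2 y\<close> its relators become five squares \<open>z s\<^sub>i = s\<^sub>j z'\<close>, which are the
  2-cells of a nonpositively curved square complex with one vertex. Pushing \<open>x\<^sup>\<plusminus>\<^sup>1, y\<^sup>\<plusminus>\<^sup>1\<close> to the right
  past rungs is a complete rewriting system whose normal forms are geodesic, so the Cayley graph is
  a median graph. As no flat \<open>7 \<times> 2\<close> rectangle exists, two geodesic prefixes of one element cannot
  diverge for long, and this is the four-point condition.

  For \<open>k > 0\<close> put \<open>c = t\<close>, \<open>a = x c\<^sup>-\<^sup>k\<close> and \<open>a\<^sub>i = c\<^sup>i a c\<^sup>-\<^sup>i\<close>. Then \<open>y = a\<^sub>1 c\<^sup>k\<close>, and the long relator reads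
  \<open>a\<^sub>0 a\<^sub>k\<^sub>+\<^sub>1 a\<^sub>2\<^sub>k a\<^sub>3\<^sub>k = a\<^sub>2 a\<^sub>k\<^sub>+\<^sub>1 a\<^sub>2\<^sub>k\<^sub>+\<^sub>2 a\<^sub>3\<^sub>k\<^sub>+\<^sub>2\<close>. Its extreme generators occur only once, so
  conjugation by \<open>c\<close> is an automorphism of the free group on \<open>a\<^sub>0, \<dots>, a\<^sub>3\<^sub>k\<^sub>+\<^sub>1\<close> and \<open>G\<close> is an extension
  of it by \<open>\<int>\<close>. The homomorphisms with \<open>x, y \<mapsto> k\<close> and \<open>t \<mapsto> 1\<close> are epimorphisms onto \<open>\<int>\<close>.
\<close>


section \<open>Transfer along isomorphisms\<close>

lemma foldr_mult_hom:
  assumes "group G" "group H" "f \<in> hom G H" "set ws \<subseteq> carrier G"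
  shows "foldr (monoid.mult G) ws \<one>\<^bsub>G\<^esub> \<in> carrier G"
    "f (foldr (monoid.mult G) ws \<one>\<^bsub>G\<^esub>) = foldr (monoid.mult H) (map f ws) \<one>\<^bsub>H\<^esub>"
proof -
  interpret G: group G by fact
  have "foldr (monoid.mult G) ws \<one>\<^bsub>G\<^esub> \<in> carrier G \<and>
    f (foldr (monoid.mult G) ws \<one>\<^bsub>G\<^esub>) = foldr (monoid.mult H) (map f ws) \<one>\<^bsub>H\<^esub>"
    using assms(4) by (induction ws) (auto simp: hom_one[OF assms(3,1,2)] hom_mult[OF assms(3)])
  then show "foldr (monoid.mult G) ws \<one>\<^bsub>G\<^esub> \<in> carrier G"
    "f (foldr (monoid.mult G) ws \<one>\<^bsub>G\<^esub>) = foldr (monoid.mult H) (map f ws) \<one>\<^bsub>H\<^esub>" by auto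
qed

text \<open>Words over \<open>S\<close> and its inverses correspond letter by letter to words over
  the image of \<open>S\<close>. Injectivity of \<open>f\<close> makes them spell corresponding
  elements, so both \<open>LEAST\<close> range over the same predicate.\<close>

lemma word_length_iso:
  assumes G: "group G" and H: "group H" and f: "f \<in> iso G H" and S: "S \<subseteq> carrier G"
    and g: "g \<in> carrier G"
  shows "word_length H (f ` S) (f g) = word_length G S g"
proof -
  interpret f: group_hom G H f
    using G H f by (simp add: group_hom_def group_hom_axioms_def iso_def)
  have inj: "inj_on f (carrier G)" using f by (simp add: iso_def bij_betw_def)
  have gens: "f ` S \<union> m_inv H ` f ` S = f ` (S \<union> m_inv G ` S)"
  proof -
    have "m_inv H ` f ` S = f ` m_inv G ` S"
      using S by (force simp: image_image intro!: image_cong)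
    then show ?thesis by (simp add: image_Un)
  qed
  have sub: "S \<union> m_inv G ` S \<subseteq> carrier G" using S by auto
  have "(\<exists>vs. length vs = n \<and> set vs \<subseteq> f ` (S \<union> m_inv G ` S) \<and> foldr (monoid.mult H) vs \<one>\<^bsub>H\<^esub> = f g) \<longleftrightarrow>
        (\<exists>ws. length ws = n \<and> set ws \<subseteq> S \<union> m_inv G ` S \<and> foldr (monoid.mult G) ws \<one>\<^bsub>G\<^esub> = g)" for n
  proof safe
    fix vs assume vs: "set vs \<subseteq> f ` (S \<union> m_inv G ` S)" "foldr (monoid.mult H) vs \<one>\<^bsub>H\<^esub> = f g"
    then have "vs \<in> map f ` lists (S \<union> m_inv G ` S)" unfolding lists_image[symmetric] by auto
    then obtain ws where ws: "vs = map f ws" "set ws \<subseteq> S \<union> m_inv G ` S"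
      by auto
    have ws': "set ws \<subseteq> carrier G" using ws sub by blast
    have "foldr (monoid.mult G) ws \<one>\<^bsub>G\<^esub> = g"
      using foldr_mult_hom[OF G H f.homh ws'] vs ws inj g by (auto dest: inj_onD)
    then show "\<exists>ws. length ws = length vs \<and> set ws \<subseteq> S \<union> m_inv G ` S \<and> foldr (monoid.mult G) ws \<one>\<^bsub>G\<^esub> = g"
      using ws by (intro exI[of _ ws]) simp
  next
    fix ws assume ws: "set ws \<subseteq> S \<union> m_inv G ` S" and "g = foldr (monoid.mult G) ws \<one>\<^bsub>G\<^esub>"
    then show "\<exists>vs. length vs = length ws \<and> set vs \<subseteq> f ` (S \<union> m_inv G ` S) \<and>
        foldr (monoid.mult H) vs \<one>\<^bsub>H\<^esub> = f (foldr (monoid.mult G) ws \<one>\<^bsub>G\<^esub>)"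
      using foldr_mult_hom[OF G H f.homh] ws sub
      by (intro exI[of _ "map f ws"]) (auto simp: subset_trans)
  qed
  then show ?thesis unfolding word_length_def gens by simp
qed

lemma hyperbolic_group_iso:
  assumes "hyperbolic_group G" "group H" "G \<cong> H"
  shows "hyperbolic_group H"
proof -
  obtain S where S: "finite S" "S \<subseteq> carrier G" "generate G S = carrier G"
      "gromov_hyperbolic_on (carrier G) (word_dist G S)" and G: "group G"
    using assms(1) by (auto simp: hyperbolic_group_def)
  obtain f where f: "f \<in> iso G H" using assms(3) by (auto simp: is_iso_def)
  interpret f: group_hom G H f
    using G assms(2) f by (simp add: group_hom_def group_hom_axioms_def iso_def)
  have surj: "f ` carrier G = carrier H" using f by (simp add: iso_def bij_betw_def)
  have d: "word_dist H (f ` S) (f g) (f h) = word_dist G S g h" if "g \<in> carrier G" "h \<in> carrier G" for g h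
    using word_length_iso[OF G assms(2) f S(2), of "inv\<^bsub>G\<^esub> g \<otimes>\<^bsub>G\<^esub> h"] that by (simp add: word_dist_def)
  have "gromov_hyperbolic_on (carrier H) (word_dist H (f ` S))"
    using S(4) unfolding gromov_hyperbolic_on_def gromov_product_def surj[symmetric] by (simp add: d)
  moreover have "generate H (f ` S) = carrier H"
    using f.generate_img[OF S(2)] S(3) surj by simp
  moreover have "f ` S \<subseteq> carrier H" using S(2) surj by blast
  ultimately show ?thesis
    unfolding hyperbolic_group_def using S(1) assms(2) by blast
qed

text \<open>Precomposing with an isomorphism and restricting again gives extensional epimorphisms.
  No two are identified, because the isomorphism reaches all of \<open>carrier Q\<close>, outside of
  which extensional functions agree.\<close>

lemma infinite_epimorphisms_iso:
  assumes "group G" "G \<cong> Q" "infinite (epimorphisms Q H)"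
  shows "infinite (epimorphisms G H)"
proof
  assume fin: "finite (epimorphisms G H)"
  obtain h where h: "h \<in> iso G Q" using assms(2) by (auto simp: is_iso_def)
  then have bij: "bij_betw h (carrier G) (carrier Q)" and hom: "h \<in> hom G Q" by (auto simp: iso_def)
  let ?T = "\<lambda>f. restrict (f \<circ> h) (carrier G)"
  have "?T f \<in> epimorphisms G H" if "f \<in> epimorphisms Q H" for f
  proof -
    have f: "f \<in> hom Q H" "f ` carrier Q = carrier H" using that by (auto simp: epimorphisms_def epi_def)
    have "f \<circ> h \<in> hom G H" using hom_compose[OF hom f(1)] .
    then have "?T f \<in> hom G H" using group.is_monoid[OF assms(1)]
      by (auto simp: hom_def Pi_def monoid.m_closed)
    moreover have "?T f ` carrier G = carrier H"
      using f(2) bij by (simp add: bij_betw_def image_image[of f h, symmetric])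
    ultimately show ?thesis by (simp add: epimorphisms_def epi_def)
  qed
  then have "?T ` epimorphisms Q H \<subseteq> epimorphisms G H" by blast
  then have "finite (?T ` epimorphisms Q H)" using fin finite_subset by blast
  moreover have "inj_on ?T (epimorphisms Q H)"
  proof (rule inj_onI)
    fix f g assume fg: "f \<in> epimorphisms Q H" "g \<in> epimorphisms Q H" "?T f = ?T g"
    have "f q = g q" if "q \<in> carrier Q" for q
    proof -
      obtain a where "a \<in> carrier G" "q = h a" using bij \<open>q \<in> carrier Q\<close> by (auto simp: bij_betw_def)
      then show ?thesis using fun_cong[OF fg(3), of a] by simp
    qed
    then show "f = g" using fg(1,2) by (auto simp: epimorphisms_def intro: extensionalityI)
  qed
  ultimately have "finite (epimorphisms Q H)" by (rule finite_imageD)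
  then show False using assms(3) by simp
qed

lemma is_free_by_Z_iso:
  assumes "G \<cong> H" "is_free_by_Z H n"
  shows "is_free_by_Z G n"
proof -
  obtain \<phi> where \<phi>: "\<phi> \<in> hom integer_group (AutoGroup (free_group {..<n}))"
      and H: "H \<cong> semidirect_product (free_group {..<n}) integer_group \<phi>"
    using assms(2) by (auto simp: is_free_by_Z_def)
  have iso: "G \<cong> semidirect_product (free_group {..<n}) integer_group \<phi>"
    by (rule iso_trans[OF assms(1) H])
  show ?thesis
    unfolding is_free_by_Z_def Bex_def by (rule exI[where x = \<phi>], rule conjI[OF \<phi> iso])
qed

section \<open>Homomorphisms from free groups and from cyclic extensions\<close>

text \<open>The homomorphism given by the universal property of the free group. The fold also
  accepts unreduced words, so that cancellation can be handled one letter at a time.\<close>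

definition free_eval :: "('b, 'c) monoid_scheme \<Rightarrow> ('a \<Rightarrow> 'b) \<Rightarrow> 'a letter list \<Rightarrow> 'b" where
  "free_eval H f w =
     foldr (\<lambda>l a. (if fst l then f (snd l) else inv\<^bsub>H\<^esub> f (snd l)) \<otimes>\<^bsub>H\<^esub> a) w \<one>\<^bsub>H\<^esub>"

lemma carrier_free_group: "w \<in> carrier (free_group S) \<longleftrightarrow> reduced w \<and> snd ` set w \<subseteq> S"
  by (simp add: free_group_def)

lemma one_free_group: "\<one>\<^bsub>free_group S\<^esub> = []"
  by (simp add: free_group_def)

lemma mult_free_group: "u \<otimes>\<^bsub>free_group S\<^esub> v = foldr cons_letter u v"
  by (simp add: free_group_def)

lemma generator_in_free_group: "x \<in> S \<Longrightarrow> [(b, x)] \<in> carrier (free_group S)"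
  by (simp add: carrier_free_group reduced_Cons)

lemma (in group) free_eval_closed:
  "snd ` set w \<subseteq> S \<Longrightarrow> f \<in> S \<rightarrow> carrier G \<Longrightarrow> free_eval G f w \<in> carrier G"
  unfolding free_eval_def by (induction w) auto

text \<open>A cancelling pair evaluates to the unit, so free reduction is invisible to the
  evaluation; this makes it multiplicative.\<close>

lemma (in group) free_eval_cons_letter:
  assumes "snd ` set (l # w) \<subseteq> S" "f \<in> S \<rightarrow> carrier G"
  shows "free_eval G f (cons_letter l w) = free_eval G f (l # w)"
proof (cases w)
  case (Cons k v)
  have "free_eval G f v \<in> carrier G" "f (snd l) \<in> carrier G"
    using assms by (auto simp: Cons intro: free_eval_closed)
  then show ?thesis
    by (cases "fst l")
      (auto simp: Cons cons_letter_Cons free_eval_def inv_letter_def simp flip: m_assoc)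
qed simp

lemma (in group) free_eval_hom:
  assumes f: "f \<in> S \<rightarrow> carrier G"
  shows "free_eval G f \<in> hom (free_group S) G"
proof (rule homI)
  fix u v assume u: "u \<in> carrier (free_group S)" and v: "v \<in> carrier (free_group S)"
  have "snd ` set u \<subseteq> S" using u by (simp add: carrier_free_group)
  then show "free_eval G f (u \<otimes>\<^bsub>free_group S\<^esub> v) = free_eval G f u \<otimes> free_eval G f v"
    unfolding mult_free_group
  proof (induction u)
    case Nil
    have "snd ` set v \<subseteq> S" using v by (simp add: carrier_free_group)
    from free_eval_closed[OF this f] show ?case by (simp add: free_eval_def)
  next
    case (Cons l u)
    have v': "snd ` set v \<subseteq> S" using v by (simp add: carrier_free_group)
    have "snd ` set (foldr cons_letter u v) \<subseteq> S"
      using letters_foldr_cons[of u v] v' Cons.prems by (simp add: subset_trans le_sup_iff)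
    then have "free_eval G f (foldr cons_letter (l # u) v) = free_eval G f (l # foldr cons_letter u v)"
      using free_eval_cons_letter[OF _ f] Cons.prems by simp
    also have "\<dots> = free_eval G f (l # u) \<otimes> free_eval G f v"
    proof -
      have "f (snd l) \<in> carrier G" "free_eval G f u \<in> carrier G"
        using Cons.prems f free_eval_closed[of u S f] by auto
      then show ?thesis
        using Cons free_eval_closed[OF v' f] by (simp add: free_eval_def m_assoc)
    qed
    finally show ?case .
  qed
qed (auto simp: carrier_free_group intro: free_eval_closed[OF _ f])

lemma (in group) free_eval_generator [simp]: "f x \<in> carrier G \<Longrightarrow> free_eval G f [(True, x)] = f x"
  by (simp add: free_eval_def)

text \<open>Uniqueness half of the universal property: a negative letter is the inverse of the
  positive one, and a reduced word is the product of its first letter and its tail.\<close>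

lemma free_group_hom_eqI:
  assumes H: "group H" and f: "f \<in> hom (free_group S) H" and g: "g \<in> hom (free_group S) H"
    and eq: "\<And>x. x \<in> S \<Longrightarrow> f [(True, x)] = g [(True, x)]" and w: "w \<in> carrier (free_group S)"
  shows "f w = g w"
proof -
  interpret F: group "free_group S" by (rule group_free_group)
  interpret f: group_hom "free_group S" H f
    using H f by (simp add: group_hom_def group_hom_axioms_def F.is_group)
  interpret g: group_hom "free_group S" H g
    using H g by (simp add: group_hom_def group_hom_axioms_def F.is_group)
  have gen: "f [l] = g [l]" if "snd l \<in> S" for l
  proof (cases "fst l")
    case True
    then show ?thesis using eq[OF that] by (metis prod.collapse)
  next
    case False
    have "inv\<^bsub>free_group S\<^esub> [(True, snd l)] = [(False, snd l)]"
      using that by (intro F.inv_equality)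
        (auto simp: mult_free_group one_free_group generator_in_free_group cons_letter_Cons inv_letter_def)
    then have "[l] = inv\<^bsub>free_group S\<^esub> [(True, snd l)]" using False by (metis prod.collapse)
    then show ?thesis
      using eq[OF that] that by (simp add: generator_in_free_group)
  qed
  show ?thesis using w
  proof (induction w)
    case Nil
    then show ?case using f.hom_one g.hom_one by (simp add: one_free_group)
  next
    case (Cons l w)
    then have c: "w \<in> carrier (free_group S)" "[l] \<in> carrier (free_group S)" "snd l \<in> S"
      by (auto simp: carrier_free_group reduced_Cons)
    have "l # w = [l] \<otimes>\<^bsub>free_group S\<^esub> w"
      using Cons.prems by (cases w) (auto simp: mult_free_group carrier_free_group reduced_Cons cons_letter_Cons)
    then show ?case using c Cons.IH gen by simp
  qed
qed

text \<open>The restriction appears because members of \<open>AutoGroup\<close> are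
  extensional.\<close>

lemma AutoGroupI:
  assumes "group N" "f \<in> hom N N" "g \<in> hom N N"
    and "\<And>a. a \<in> carrier N \<Longrightarrow> g (f a) = a" "\<And>a. a \<in> carrier N \<Longrightarrow> f (g a) = a"
  shows "restrict f (carrier N) \<in> carrier (AutoGroup N)"
proof -
  have "bij_betw f (carrier N) (carrier N)"
    using assms by (intro bij_betwI[of _ _ _ g]) (auto simp: hom_def)
  then have "bij_betw (restrict f (carrier N)) (carrier N) (carrier N)"
    by (simp add: bij_betw_restrict_eq)
  moreover have "restrict f (carrier N) \<in> hom N N"
    using assms(2) monoid.m_closed[OF group.is_monoid[OF assms(1)]] by (auto simp: hom_def Pi_def)
  ultimately show ?thesis by (simp add: AutoGroup_def auto_def Bij_def)
qed

section \<open>Extension of a group by the powers of one automorphism\<close>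

locale cyclic_extension = N: group N for N :: "('a, 'c) monoid_scheme" (structure) +
  fixes \<alpha> :: "'a \<Rightarrow> 'a"
  assumes \<alpha>: "\<alpha> \<in> carrier (AutoGroup N)"
begin

interpretation A: group "AutoGroup N" by (rule N.AutoGroup)

definition \<phi> :: "int \<Rightarrow> 'a \<Rightarrow> 'a" where
  "\<phi> j = \<alpha> [^]\<^bsub>AutoGroup N\<^esub> j"

lemma \<phi>_hom: "\<phi> \<in> hom integer_group (AutoGroup N)"
  unfolding \<phi>_def[abs_def] using A.hom_integer_group_pow[OF \<alpha>] by simp

abbreviation E where "E \<equiv> semidirect_product N integer_group \<phi>"

sublocale E: group E
  by (rule group_semidirect_product[OF N.is_group group_integer_group \<phi>_hom])

lemma carrier_E [simp]: "(a, j) \<in> carrier E \<longleftrightarrow> a \<in> carrier N"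
  by (simp add: semidirect_product_def)

lemma mult_E [simp]: "(a, i) \<otimes>\<^bsub>E\<^esub> (b, j) = (a \<otimes> \<phi> i b, i + j)"
  by (simp add: semidirect_product_def)

lemma \<phi>_auto: "\<phi> j \<in> hom N N" "\<phi> j \<in> Bij (carrier N)"
  using hom_in_carrier[OF \<phi>_hom, of j] by (auto simp: AutoGroup_def auto_def)

lemma \<phi>_closed [simp]: "a \<in> carrier N \<Longrightarrow> \<phi> j a \<in> carrier N"
  using \<phi>_auto(1) by (rule hom_in_carrier)

lemma \<phi>_one [simp]: "\<phi> j \<one> = \<one>"
  using hom_one[OF \<phi>_auto(1) N.is_group N.is_group] .

lemma \<phi>_mult: "a \<in> carrier N \<Longrightarrow> b \<in> carrier N \<Longrightarrow> \<phi> j (a \<otimes> b) = \<phi> j a \<otimes> \<phi> j b"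
  using \<phi>_auto(1) by (rule hom_mult)

lemma \<phi>_add: "a \<in> carrier N \<Longrightarrow> \<phi> (i + j) a = \<phi> i (\<phi> j a)"
  using hom_mult[OF \<phi>_hom, of i j] \<phi>_auto(2)
  by (simp add: AutoGroup_def BijGroup_def compose_def)

lemma \<phi>_0 [simp]: "a \<in> carrier N \<Longrightarrow> \<phi> 0 a = a"
  using hom_one[OF \<phi>_hom group_integer_group A.is_group] by (simp add: AutoGroup_def BijGroup_def)

lemma \<phi>_1: "\<phi> 1 = \<alpha>"
  unfolding \<phi>_def using A.int_pow_1[OF \<alpha>] .

lemma pow_E: "(\<one>, 1) [^]\<^bsub>E\<^esub> (j::int) = (\<one>, j)"
proof -
  have "(\<lambda>j. (\<one>, j)) \<in> hom integer_group E"
    by (auto simp: hom_def)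
  from group_hom.hom_int_pow[of integer_group E "\<lambda>j. (\<one>, j)" 1 j] this show ?thesis
    by (simp add: group_hom_def group_hom_axioms_def E.is_group del: one_integer_group)
qed

text \<open>Universal property of \<open>E\<close>: \<open>c\<close> is the image of the stable
  letter, and \<open>conj\<close> says that conjugation by \<open>c\<close> induces \<alpha> on the
  image of \<open>N\<close>.\<close>

lemma hom_from_E:
  assumes Q: "group Q" and e: "e \<in> hom N Q" and c: "c \<in> carrier Q"
    and conj: "\<And>a. a \<in> carrier N \<Longrightarrow> e (\<alpha> a) \<otimes>\<^bsub>Q\<^esub> c = c \<otimes>\<^bsub>Q\<^esub> e a"
  shows "(\<lambda>(a, j). e a \<otimes>\<^bsub>Q\<^esub> c [^]\<^bsub>Q\<^esub> (j::int)) \<in> hom E Q"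
proof -
  interpret Q: group Q by fact
  have e_closed [simp]: "e a \<in> carrier Q" if "a \<in> carrier N" for a
    using e that by (rule hom_in_carrier)
  have e_mult: "e (a \<otimes> b) = e a \<otimes>\<^bsub>Q\<^esub> e b" if "a \<in> carrier N" "b \<in> carrier N" for a b
    using e that by (rule hom_mult)
  have step: "e (\<phi> (j + 1) a) = c \<otimes>\<^bsub>Q\<^esub> e (\<phi> j a) \<otimes>\<^bsub>Q\<^esub> inv\<^bsub>Q\<^esub> c" if "a \<in> carrier N" for j a
  proof -
    have "\<phi> (j + 1) a = \<alpha> (\<phi> j a)" using \<phi>_add[OF that, of 1 j] by (simp add: \<phi>_1 add.commute)
    moreover have "\<phi> j a \<in> carrier N" "\<alpha> (\<phi> j a) \<in> carrier N"
      using that \<phi>_closed[of "\<phi> j a" 1] by (auto simp: \<phi>_1)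
    ultimately show ?thesis using conj[of "\<phi> j a"] c
      by (metis Q.inv_solve_right' Q.m_closed e_closed)
  qed
  have c1: "c [^]\<^bsub>Q\<^esub> (j + 1) = c \<otimes>\<^bsub>Q\<^esub> c [^]\<^bsub>Q\<^esub> j" for j :: int
    using Q.int_pow_mult[OF c, of 1 j] c by (simp add: add.commute Q.int_pow_1)
  \<comment> \<open>This moves every power of \<open>c\<close> past the image of \<open>N\<close>.
    For negative exponents one multiplies by \<open>c\<close> on the left, uses the known case and
    cancels.\<close>
  have main: "e (\<phi> j a) \<otimes>\<^bsub>Q\<^esub> c [^]\<^bsub>Q\<^esub> j = c [^]\<^bsub>Q\<^esub> j \<otimes>\<^bsub>Q\<^esub> e a" if a: "a \<in> carrier N" for j :: int and a
  proof (induction j rule: int_induct[where k = 0])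
    case base
    then show ?case using a by simp
  next
    case (step1 i)
    have "e (\<phi> (i + 1) a) \<otimes>\<^bsub>Q\<^esub> c [^]\<^bsub>Q\<^esub> (i + 1) = c \<otimes>\<^bsub>Q\<^esub> (e (\<phi> i a) \<otimes>\<^bsub>Q\<^esub> c [^]\<^bsub>Q\<^esub> i)"
      using a c by (simp add: step c1 Q.m_assoc) (simp flip: Q.m_assoc)
    then show ?case using step1 a c by (simp add: c1 Q.m_assoc)
  next
    case (step2 i)
    have "c \<otimes>\<^bsub>Q\<^esub> (e (\<phi> (i - 1) a) \<otimes>\<^bsub>Q\<^esub> c [^]\<^bsub>Q\<^esub> (i - 1)) = e (\<phi> i a) \<otimes>\<^bsub>Q\<^esub> c [^]\<^bsub>Q\<^esub> i"
      using a c step[OF a, of "i - 1"] c1[of "i - 1"]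
      by (simp add: Q.m_assoc) (simp flip: Q.m_assoc)
    also have "\<dots> = c \<otimes>\<^bsub>Q\<^esub> (c [^]\<^bsub>Q\<^esub> (i - 1) \<otimes>\<^bsub>Q\<^esub> e a)"
      using a c step2 c1[of "i - 1"] by (simp add: Q.m_assoc)
    finally show ?case using a c by (simp add: Q.l_cancel)
  qed
  show ?thesis
  proof (rule homI)
    fix p q assume "p \<in> carrier E" "q \<in> carrier E"
    then obtain a i b j where pq: "p = (a, i)" "q = (b, j)" "a \<in> carrier N" "b \<in> carrier N"
      by (cases p; cases q) auto
    have "e (a \<otimes> \<phi> i b) \<otimes>\<^bsub>Q\<^esub> c [^]\<^bsub>Q\<^esub> (i + j)
        = e a \<otimes>\<^bsub>Q\<^esub> (e (\<phi> i b) \<otimes>\<^bsub>Q\<^esub> c [^]\<^bsub>Q\<^esub> i) \<otimes>\<^bsub>Q\<^esub> c [^]\<^bsub>Q\<^esub> j"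
      using pq c by (simp add: e_mult Q.int_pow_mult Q.m_assoc)
    also have "\<dots> = (e a \<otimes>\<^bsub>Q\<^esub> c [^]\<^bsub>Q\<^esub> i) \<otimes>\<^bsub>Q\<^esub> (e b \<otimes>\<^bsub>Q\<^esub> c [^]\<^bsub>Q\<^esub> j)"
      using pq c by (simp add: main Q.m_assoc)
    finally show "(case p \<otimes>\<^bsub>E\<^esub> q of (a, j) \<Rightarrow> e a \<otimes>\<^bsub>Q\<^esub> c [^]\<^bsub>Q\<^esub> j) =
        (case p of (a, j) \<Rightarrow> e a \<otimes>\<^bsub>Q\<^esub> c [^]\<^bsub>Q\<^esub> j) \<otimes>\<^bsub>Q\<^esub> (case q of (a, j) \<Rightarrow> e a \<otimes>\<^bsub>Q\<^esub> c [^]\<^bsub>Q\<^esub> j)"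
      by (simp add: pq)
  qed (use c in auto)
qed

end

section \<open>Groups of square complexes with one vertex\<close>

definition inv_gen :: "'x letter + 's letter \<Rightarrow> 'x letter + 's letter" where
  "inv_gen = map_sum inv_letter inv_letter"

lemma inv_gen_simps [simp]:
  "inv_gen (Inl x) = Inl (inv_letter x)" "inv_gen (Inr s) = Inr (inv_letter s)"
  by (simp_all add: inv_gen_def)

lemma inv_gen_inv_gen [simp]: "inv_gen (inv_gen l) = l"
  by (cases l) auto

lemma inv_letter_eq_iff: "inv_letter k = l \<longleftrightarrow> k = inv_letter l"
  by auto

text \<open>
  \<open>sq x s = Some (s', x')\<close> encodes the square relation \<open>x s = s' x'\<close>. The assumptions close the set of
  squares under reading a square from its other corners.
\<close>

locale square_system =
  fixes sq :: "'x letter \<Rightarrow> 's letter \<Rightarrow> ('s letter \<times> 'x letter) option"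
  assumes sq_inv_left: "sq x s = Some (s', x') \<Longrightarrow> sq (inv_letter x) s' = Some (s, inv_letter x')"
    and sq_inv_right: "sq x s = Some (s', x') \<Longrightarrow> sq x' (inv_letter s) = Some (inv_letter s', x)"
begin

text \<open>The excluded neighbours are the redexes of the rewriting system: a cancelling pair, or
  an \<open>Inl\<close> letter that a square lets pass the rung to its right.\<close>

definition adjacent :: "'x letter + 's letter \<Rightarrow> 'x letter + 's letter \<Rightarrow> bool" where
  "adjacent k l \<longleftrightarrow> l \<noteq> inv_gen k \<and> (\<forall>x s. k = Inl x \<longrightarrow> l = Inr s \<longrightarrow> sq x s = None)"

definition nf :: "('x letter + 's letter) list \<Rightarrow> bool" where
  "nf = successively adjacent"

lemma nf_Nil [simp]: "nf []"
  by (simp add: nf_def)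

lemma nf_Cons: "nf (l # w) \<longleftrightarrow> nf w \<and> (w = [] \<or> adjacent l (hd w))"
  by (auto simp: nf_def successively_Cons)

lemma adjacent_simps [simp]:
  "adjacent (Inl x) (Inl z) \<longleftrightarrow> z \<noteq> inv_letter x"
  "adjacent (Inr s) (Inr t) \<longleftrightarrow> t \<noteq> inv_letter s"
  "adjacent (Inl x) (Inr s) \<longleftrightarrow> sq x s = None"
  "adjacent (Inr s) (Inl x)"
  by (auto simp: adjacent_def)

section \<open>Left multiplication of normal forms by a letter\<close>

fun push :: "'x letter \<Rightarrow> ('x letter + 's letter) list \<Rightarrow> ('x letter + 's letter) list" where
  "push x [] = [Inl x]"
| "push x (Inl z # w) = (if z = inv_letter x then w else Inl x # Inl z # w)"
| "push x (Inr s # w) =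
     (case sq x s of None \<Rightarrow> Inl x # Inr s # w | Some (s', x') \<Rightarrow> Inr s' # push x' w)"

fun act :: "'x letter + 's letter \<Rightarrow> ('x letter + 's letter) list \<Rightarrow> ('x letter + 's letter) list" where
  "act (Inl x) w = push x w"
| "act (Inr s) w = (if w \<noteq> [] \<and> hd w = Inr (inv_letter s) then tl w else Inr s # w)"

text \<open>If \<open>x'\<close> next passes a rung \<open>t\<close>, a cancelling pair would force
  \<open>t\<close> to be the inverse of \<open>s\<close>, by reading the square from another corner.
  If \<open>x'\<close> cancels with an \<open>Inl\<close> letter, that letter would have a square
  with the rung behind it. Both contradict normality.\<close>

lemma nf_push_no_cancel:
  assumes "nf (Inr s # w)" "sq x s = Some (s', x')"
  shows "push x' w = [] \<or> hd (push x' w) \<noteq> Inr (inv_letter s')"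
proof (cases w)
  case (Cons a v)
  have b: "sq x' (inv_letter s) = Some (inv_letter s', x)"
    using sq_inv_right[OF assms(2)] .
  show ?thesis
  proof (cases a)
    case (Inl z)
    have "sq (inv_letter x') (inv_letter s') \<noteq> None"
      using sq_inv_left[OF b] by simp
    then show ?thesis using assms(1)
      by (auto simp: Cons Inl nf_Cons)
  next
    case (Inr t)
    have "t \<noteq> inv_letter s" using assms(1) by (simp add: Cons Inr nf_Cons)
    moreover have "t = inv_letter s" if "sq x' t = Some (inv_letter s', x'')" for x''
      using sq_inv_left[OF that] sq_inv_left[OF b] by simp
    ultimately show ?thesis
      by (auto simp: Cons Inr split: option.splits)
  qed
qed simp

lemma nf_push: "nf w \<Longrightarrow> nf (push x w)"
proof (induction x w rule: push.induct)
  case (3 x s w)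
  show ?case
  proof (cases "sq x s")
    case None
    then show ?thesis using 3 by (simp add: nf_Cons)
  next
    case (Some p)
    obtain s' x' where p: "p = (s', x')" by (cases p)
    have "nf (push x' w)" using 3 Some p by (simp add: nf_Cons)
    moreover have "push x' w = [] \<or> hd (push x' w) \<noteq> Inr (inv_letter s')"
      using nf_push_no_cancel 3(2) Some p by blast
    ultimately show ?thesis
      using Some p by (cases "hd (push x' w)") (auto simp: nf_Cons)
  qed
qed (auto simp: nf_Cons)

lemma nf_act: "nf w \<Longrightarrow> nf (act l w)"
proof (cases l)
  case (Inr s)
  assume "nf w"
  then show ?thesis
    by (cases w; cases "hd w") (auto simp: Inr nf_Cons)
qed (simp add: nf_push)

text \<open>Each square crossed by the first push is crossed backwards by the second, by
  \<open>sq_inv_left\<close>. If the first push cancelled a letter, normality stops the second one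
  at that place, so the letter is restored.\<close>

lemma push_inverse: "nf w \<Longrightarrow> push x (push (inv_letter x) w) = w"
proof (induction "inv_letter x" w arbitrary: x rule: push.induct)
  case (2 z w)
  show ?case
  proof (cases "z = x")
    case True
    then show ?thesis using 2
      by (cases w; cases "hd w") (auto simp: nf_Cons)
  qed (use 2 in auto)
next
  case (3 s w)
  show ?case
  proof (cases "sq (inv_letter x) s")
    case None
    then show ?thesis by simp
  next
    case (Some p)
    obtain s' x' where p: "p = (s', x')" by (cases p)
    have "sq x s' = Some (s, inv_letter x')" using sq_inv_left Some p by fastforce
    moreover have "push (inv_letter x') (push x' w) = w"
      using 3(1)[OF Some, of s' "inv_letter x'"] 3(2) p by (simp add: nf_Cons)
    ultimately show ?thesis using Some p by simp
  qed
qed auto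

lemma act_inverse: "nf w \<Longrightarrow> act l (act (inv_gen l) w) = w"
proof (cases l)
  case (Inl x)
  assume "nf w"
  then show ?thesis by (simp add: Inl push_inverse)
next
  case (Inr s)
  assume "nf w"
  then show ?thesis
    by (cases w; cases "tl w") (auto simp: Inr nf_Cons)
qed

text \<open>The square relations hold for the action. The delicate case is a rung cancelling with
  the head of \<open>w\<close>: there \<open>sq_inv_right\<close> carries the other letter past that
  head.\<close>

lemma act_square:
  assumes "nf w" "sq x s = Some (s', x')"
  shows "act (Inl x) (act (Inr s) w) = act (Inr s') (act (Inl x') w)"
proof (cases "w \<noteq> [] \<and> hd w = Inr (inv_letter s)")
  case True
  then obtain v where w: "w = Inr (inv_letter s) # v" by (cases w) auto
  show ?thesis
    using sq_inv_right[OF assms(2)] by (simp add: w)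
next
  case False
  then have "nf (Inr s # w)"
    using assms(1) by (cases w; cases "hd w") (auto simp: nf_Cons)
  from nf_push_no_cancel[OF this assms(2)] False show ?thesis
    using assms(2) by auto
qed

lemma length_push: "length (push x w) = Suc (length w) \<or> Suc (length (push x w)) = length w"
  by (induction x w rule: push.induct) (auto split: option.splits)

lemma length_act: "length (act l w) = Suc (length w) \<or> Suc (length (act l w)) = length w"
proof (cases l)
  case (Inl x)
  then show ?thesis using length_push[of x w] by simp
qed (cases w; simp)

lemma act_Cons: "nf (l # w) \<Longrightarrow> act l w = l # w"
  by (cases l; cases w; cases "hd w") (auto simp: nf_Cons)

section \<open>The group structure on normal forms\<close>

definition word_group :: "('x letter + 's letter) list monoid" where
  "word_group = \<lparr>carrier = {w. nf w}, monoid.mult = (\<lambda>u v. foldr act u v), one = []\<rparr>"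

lemma carrier_word_group [simp]: "w \<in> carrier word_group \<longleftrightarrow> nf w"
  by (simp add: word_group_def)

lemma one_word_group [simp]: "\<one>\<^bsub>word_group\<^esub> = []"
  by (simp add: word_group_def)

lemma mult_word_group: "u \<otimes>\<^bsub>word_group\<^esub> v = foldr act u v"
  by (simp add: word_group_def)

lemma nf_foldr_act: "nf w \<Longrightarrow> nf (foldr act u w)"
  by (induction u) (auto simp: nf_act)

lemma foldr_act_Nil: "nf w \<Longrightarrow> foldr act w [] = w"
proof (induction w)
  case (Cons l w)
  then have "foldr act w [] = w" by (simp add: nf_Cons)
  then show ?case using act_Cons[OF Cons.prems] by simp
qed simp

text \<open>Associativity rests on this: rewriting \<open>u\<close> while inserting \<open>x\<close>
  does not change how it acts, since cancellations and squares hold for the action.\<close>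

lemma foldr_act_push: "nf w \<Longrightarrow> foldr act (push x u) w = push x (foldr act u w)"
proof (induction x u rule: push.induct)
  case (2 x z u)
  have "push x (push (inv_letter x) (foldr act u w)) = foldr act u w"
    using 2 nf_foldr_act push_inverse by blast
  then show ?case by simp
next
  case (3 x s u)
  have u: "nf (foldr act u w)"
    using 3 nf_foldr_act by blast
  show ?case
  proof (cases "sq x s")
    case (Some p)
    obtain s' x' where p: "p = (s', x')" by (cases p)
    show ?thesis
      using 3(1)[OF Some p[symmetric] 3(2)] act_square[OF u, of x s s' x'] Some p
      by (simp del: act.simps(2))
  qed simp
qed simp

lemma foldr_act_act:
  assumes "nf w"
  shows "foldr act (act l u) w = act l (foldr act u w)"
proof (cases l)
  case (Inl x)
  then show ?thesis using assms by (simp add: foldr_act_push)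
next
  case (Inr s)
  show ?thesis
  proof (cases "u \<noteq> [] \<and> hd u = Inr (inv_letter s)")
    case True
    then obtain v where u: "u = Inr (inv_letter s) # v" by (cases u) auto
    have "act (Inr s) (act (Inr (inv_letter s)) (foldr act v w)) = foldr act v w"
      using act_inverse[of "foldr act v w" "Inr s"] assms nf_foldr_act by simp
    then show ?thesis by (simp add: u Inr del: act.simps(2)) (simp only: act.simps list.sel, simp)
  qed (auto simp: Inr)
qed

lemma foldr_act_assoc:
  assumes "nf w"
  shows "foldr act (foldr act u v) w = foldr act u (foldr act v w)"
  by (induction u) (auto simp: foldr_act_act assms)

lemma foldr_act_inverse:
  "nf w \<Longrightarrow> foldr act (rev (map inv_gen u)) (foldr act u w) = w"
proof (induction u arbitrary: w)
  case (Cons l u)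
  then show ?case
    using act_inverse[of "foldr act u w" "inv_gen l"]
    by (simp add: nf_foldr_act)
qed simp

sublocale Q: group word_group
proof (rule groupI)
  fix u assume u: "u \<in> carrier word_group"
  let ?v = "foldr act (rev (map inv_gen u)) []"
  have "?v \<otimes>\<^bsub>word_group\<^esub> u = []"
    using u foldr_act_inverse[of "[]" u] foldr_act_Nil[of u]
      foldr_act_assoc[of u "rev (map inv_gen u)" "[]"]
    by (simp add: mult_word_group)
  then show "\<exists>v\<in>carrier word_group. v \<otimes>\<^bsub>word_group\<^esub> u = \<one>\<^bsub>word_group\<^esub>"
    by (intro bexI[of _ ?v]) (auto simp: nf_foldr_act)
qed (auto simp: mult_word_group nf_foldr_act foldr_act_assoc)

abbreviation qmult (infixl "\<bullet>" 70) where "u \<bullet> v \<equiv> u \<otimes>\<^bsub>word_group\<^esub> v"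
abbreviation qinv where "qinv u \<equiv> inv\<^bsub>word_group\<^esub> u"

lemma act_eq_mult: "act l w = [l] \<bullet> w"
  by (simp add: mult_word_group)

lemma nf_single [simp]: "nf [l]"
  by (simp add: nf_Cons)

lemma qinv_single [simp]: "qinv [l] = [inv_gen l]"
  using act_inverse[of "[]" "inv_gen l"]
  by (intro Q.inv_equality) (auto simp: mult_word_group act_Cons simp del: act.simps)

lemma nf_mult [simp]: "nf u \<Longrightarrow> nf v \<Longrightarrow> nf (u \<bullet> v)"
  using Q.m_closed by simp

lemma nf_qinv [simp]: "nf u \<Longrightarrow> nf (qinv u)"
  using Q.inv_closed by simp

lemma length_mult_le: "length (u \<bullet> v) \<le> length u + length v"
proof (induction u)
  case (Cons l u)
  then show ?case using length_act[of l "foldr act u v"] by (auto simp: mult_word_group simp del: act.simps)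
qed (simp add: mult_word_group)

lemma length_qinv: "nf u \<Longrightarrow> length (qinv u) = length u"
proof -
  have le: "length (qinv u) \<le> length u" if "nf u" for u
  proof -
    have "qinv u = foldr act (rev (map inv_gen u)) []"
      using that foldr_act_inverse[of "[]" u] foldr_act_Nil[of u]
        foldr_act_assoc[of u "rev (map inv_gen u)" "[]"]
      by (intro Q.inv_equality) (auto simp: nf_foldr_act mult_word_group)
    also have "\<dots> = rev (map inv_gen u) \<bullet> []" by (simp add: mult_word_group)
    finally show ?thesis using length_mult_le[of "rev (map inv_gen u)" "[]"] by simp
  qed
  assume "nf u"
  then show ?thesis using le[of u] le[of "qinv u"] by simp
qed

text \<open>The descents of \<open>g\<close> are the first letters of the geodesic words for \<open>g\<close>.\<close>

definition descents :: "('x letter + 's letter) list \<Rightarrow> ('x letter + 's letter) set" where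
  "descents g = {l. length ([inv_gen l] \<bullet> g) < length g}"

lemma descents_iff: "l \<in> descents g \<longleftrightarrow> Suc (length ([inv_gen l] \<bullet> g)) = length g"
  using length_act[of "inv_gen l" g] by (auto simp: descents_def act_eq_mult)

lemma not_descent_iff: "l \<notin> descents g \<longleftrightarrow> length ([inv_gen l] \<bullet> g) = Suc (length g)"
  using length_act[of "inv_gen l" g] by (auto simp: descents_def act_eq_mult)

lemma inv_gen_mult_cancel [simp]:
  "nf w \<Longrightarrow> [l] \<bullet> ([inv_gen l] \<bullet> w) = w" "nf w \<Longrightarrow> [inv_gen l] \<bullet> ([l] \<bullet> w) = w"
  using act_inverse[of w l] act_inverse[of w "inv_gen l"] by (simp_all add: act_eq_mult)

lemma descent_mult_iff:
  assumes "nf g"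
  shows "l \<in> descents ([l] \<bullet> g) \<longleftrightarrow> length ([l] \<bullet> g) = Suc (length g)"
  using assms by (auto simp: descents_iff)

lemma hd_in_descents: "nf (l # w) \<Longrightarrow> l \<in> descents (l # w)"
proof -
  assume l: "nf (l # w)"
  then have w: "nf w" by (simp add: nf_Cons)
  have "[l] \<bullet> w = l # w" using act_Cons[OF l] by (simp add: act_eq_mult)
  then show ?thesis using descent_mult_iff[OF w, of l] by simp
qed

text \<open>Normal forms carry rungs as far left as possible, so a rung begins a geodesic only if it
  is the head.\<close>

lemma Inr_in_descents_iff: "Inr s \<in> descents g \<longleftrightarrow> g \<noteq> [] \<and> hd g = Inr s"
  by (auto simp: descents_def mult_word_group)

text \<open>Both letters travel through the leading rungs to the same cancelling letter. They are
  recovered from it backwards, since a square is determined by its rung \<open>s\<close> and its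
  outgoing letter.\<close>

lemma length_push_less_unique:
  "length (push x w) < length w \<Longrightarrow> length (push z w) < length w \<Longrightarrow> x = z"
proof (induction w arbitrary: x z)
  case (Cons a w)
  show ?case
  proof (cases a)
    case (Inl y)
    then show ?thesis using Cons by (auto simp: inv_letter_eq_iff split: if_splits)
  next
    case (Inr s)
    obtain s1 x1 where 1: "sq x s = Some (s1, x1)"
      using Cons.prems(1) Inr by (cases "sq x s") auto
    obtain s2 x2 where 2: "sq z s = Some (s2, x2)"
      using Cons.prems(2) Inr by (cases "sq z s") auto
    have "x1 = x2" using Cons 1 2 Inr by auto
    then show ?thesis using sq_inv_right[OF 1] sq_inv_right[OF 2] by simp
  qed
qed simp

lemma Inl_descent_unique: "Inl x \<in> descents g \<Longrightarrow> Inl z \<in> descents g \<Longrightarrow> x = z"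
  using length_push_less_unique[of "inv_letter x" g "inv_letter z"]
  by (simp add: descents_def mult_word_group inv_letter_eq_iff)

text \<open>As \<open>g\<close> starts with \<open>s\<close>, shortening \<open>g\<close> by
  \<open>x\<close> means carrying the inverse of \<open>x\<close> across \<open>s\<close>. The
  square permitting this has \<open>s'\<close> and \<open>x'\<close> as its far sides.\<close>

lemma descents_square:
  assumes g: "nf g" and x: "Inl x \<in> descents g" and s: "Inr s \<in> descents g"
  obtains s' x' where "sq (inv_letter x) s = Some (s', inv_letter x')"
    "[Inl x] \<bullet> [Inr s'] = [Inr s] \<bullet> [Inl x']"
    "Inr s' \<in> descents ([inv_gen (Inl x)] \<bullet> g)" "Inl x' \<in> descents ([inv_gen (Inr s)] \<bullet> g)"
proof -
  obtain w where w: "g = Inr s # w" using s by (cases g) (auto simp: Inr_in_descents_iff)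
  obtain s' z where sq: "sq (inv_letter x) s = Some (s', z)"
    using x by (cases "sq (inv_letter x) s") (auto simp: w descents_def mult_word_group)
  have "Inr s' \<in> descents ([inv_gen (Inl x)] \<bullet> g)"
    using sq by (simp add: Inr_in_descents_iff w mult_word_group)
  moreover have "Inl (inv_letter z) \<in> descents ([inv_gen (Inr s)] \<bullet> g)"
    using sq x by (simp add: descents_def w mult_word_group)
  moreover have "[Inl x] \<bullet> [Inr s'] = [Inr s] \<bullet> [Inl (inv_letter z)]"
    using act_square[OF nf_Nil sq_inv_left[OF sq]] by (simp add: mult_word_group)
  ultimately show thesis using that[of s' "inv_letter z"] sq by simp
qed

text \<open>Each kind of letter contributes at most one descent, so distinct descents are of
  different kinds and span a square.\<close>

lemma descents_diamond:
  assumes g: "nf g" and a: "a \<in> descents g" and b: "b \<in> descents g" and "a \<noteq> b"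
  obtains a' b' where "[a] \<bullet> [b'] = [b] \<bullet> [a']" "a' \<in> descents ([inv_gen b] \<bullet> g)"
proof (cases a)
  case (Inl x)
  then obtain s where "b = Inr s" using assms Inl_descent_unique by (cases b) auto
  then show ?thesis using that descents_square[OF g, of x s] a b Inl by metis
next
  case (Inr s)
  then obtain x where "b = Inl x" using assms by (cases b) (auto simp: Inr_in_descents_iff)
  then show ?thesis using that descents_square[OF g, of x s] a b Inr by metis
qed

text \<open>
  Local-to-global principle: a descent \<open>l\<close> of \<open>g\<close> that is not one of \<open>h\<close> is moved over to \<open>h\<close>. The
  common descent found by induction and \<open>l\<^sup>-\<^sup>1\<close> then span a square, whose opposite side is a common
  descent of \<open>g\<close> and \<open>h\<close>.
\<close>

lemma common_descent:
  assumes "nf g" "nf h" "length (qinv g \<bullet> h) < length g + length h"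
  shows "descents g \<inter> descents h \<noteq> {}"
  using assms
proof (induction "length g" arbitrary: g h rule: less_induct)
  case less
  show ?case
  proof (cases g)
    case Nil
    moreover have "qinv [] = []" using Q.inv_one by simp
    ultimately show ?thesis using less by (simp add: mult_word_group)
  next
    case (Cons l g')
    have g': "nf g'" using less Cons by (simp add: nf_Cons)
    have g: "g = [l] \<bullet> g'" using act_Cons[of l g'] less Cons by (simp add: act_eq_mult)
    have lg: "l \<in> descents g" using hd_in_descents less Cons by blast
    show ?thesis
    proof (cases "l \<in> descents h")
      case True
      then show ?thesis using lg by blast
    next
      case False
      define h1 where "h1 = [inv_gen l] \<bullet> h"
      have h1: "nf h1" "length h1 = Suc (length h)"
        using False not_descent_iff less by (auto simp: h1_def)
      have h: "h = [l] \<bullet> h1" using less by (simp add: h1_def)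
      have "qinv g \<bullet> h = qinv g' \<bullet> h1"
        using less g' by (simp add: g h1_def Q.inv_mult_group Q.m_assoc)
      then have "descents g' \<inter> descents h1 \<noteq> {}"
        using less.hyps[of g' h1] less.prems h1 g' Cons by simp
      then obtain k where k: "k \<in> descents g'" "k \<in> descents h1" by blast
      have "inv_gen l \<in> descents h1"
        using h h1 by (simp add: descents_def flip: h)
      \<comment> \<open>Otherwise removing \<open>k\<close> from \<open>g'\<close> would give back
        the longer element \<open>g\<close>.\<close>
      moreover have "k \<noteq> inv_gen l"
      proof
        assume "k = inv_gen l"
        then have "length g < length g'" using k(1) by (simp add: descents_def flip: g)
        then show False by (simp add: Cons)
      qed
      ultimately obtain k' l' where sq: "[k] \<bullet> [l'] = [inv_gen l] \<bullet> [k']"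
        and k': "k' \<in> descents ([inv_gen (inv_gen l)] \<bullet> h1)"
        using descents_diamond[OF h1(1) k(2), of "inv_gen l"] by metis
      have "k' \<in> descents h" using k' h by simp
      moreover have "k' \<in> descents g"
      proof -
        have "[l] \<bullet> ([k] \<bullet> [l']) = [k']" by (simp add: sq)
        then have e: "[k'] \<bullet> [inv_gen l'] = [l] \<bullet> [k]"
          by (metis Q.m_assoc Q.inv_solve_right nf_single nf_mult carrier_word_group qinv_single)
        define g2 where "g2 = [inv_gen k] \<bullet> g'"
        have g2: "nf g2" "Suc (length g2) = length g'" "g' = [k] \<bullet> g2"
          using g' k(1) by (auto simp: g2_def descents_iff)
        \<comment> \<open>From \<open>l k = k' l'\<^sup>-\<^sup>1\<close>: removing
          \<open>k'\<close> from \<open>g\<close> leaves at most \<open>length g'\<close>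
          letters.\<close>
        have "g = [k'] \<bullet> ([inv_gen l'] \<bullet> g2)"
          using e g2 by (simp add: g flip: Q.m_assoc)
        then have "[inv_gen k'] \<bullet> g = [inv_gen l'] \<bullet> g2" using g2 by simp
        then have "length ([inv_gen k'] \<bullet> g) \<le> Suc (length g2)"
          using length_mult_le[of "[inv_gen l']" g2] by simp
        then show ?thesis using g2 Cons by (simp add: descents_def)
      qed
      ultimately show ?thesis by blast
    qed
  qed
qed

section \<open>Universal property of the group of normal forms\<close>

definition word_eval :: "('b, 'c) monoid_scheme \<Rightarrow> ('x letter + 's letter \<Rightarrow> 'b) \<Rightarrow> ('x letter + 's letter) list \<Rightarrow> 'b" where
  "word_eval H f w = foldr (\<lambda>l a. f l \<otimes>\<^bsub>H\<^esub> a) w \<one>\<^bsub>H\<^esub>"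

text \<open>The group is presented by its letters and squares: \<open>push\<close> and
  \<open>act\<close> rewrite only by inverse pairs and squares, which \<open>f\<close>
  respects.\<close>

lemma word_eval_hom:
  assumes H: "group H" and f: "\<And>l. f l \<in> carrier H"
    and inv: "\<And>l. f (inv_gen l) = inv\<^bsub>H\<^esub> f l"
    and square: "\<And>x s s' x'. sq x s = Some (s', x') \<Longrightarrow>
      f (Inl x) \<otimes>\<^bsub>H\<^esub> f (Inr s) = f (Inr s') \<otimes>\<^bsub>H\<^esub> f (Inl x')"
  shows "word_eval H f \<in> hom word_group H"
proof -
  interpret H: group H by fact
  have closed [simp]: "word_eval H f w \<in> carrier H" for w
    unfolding word_eval_def using f by (induction w) auto
  have Cons [simp]: "word_eval H f (l # w) = f l \<otimes>\<^bsub>H\<^esub> word_eval H f w" for l w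
    by (simp add: word_eval_def)
  have inv': "f (Inl (inv_letter x)) = inv\<^bsub>H\<^esub> f (Inl x)" "f (Inr (inv_letter s)) = inv\<^bsub>H\<^esub> f (Inr s)" for x s
    using inv[of "Inl x"] inv[of "Inr s"] by simp_all
  have push: "word_eval H f (push x w) = f (Inl x) \<otimes>\<^bsub>H\<^esub> word_eval H f w" for x w
  proof (induction x w rule: push.induct)
    case (2 x z w)
    then show ?case using f by (simp add: inv' flip: H.m_assoc)
  next
    case (3 x s w)
    show ?case
    proof (cases "sq x s")
      case (Some p)
      obtain s' x' where p: "p = (s', x')" by (cases p)
      have "word_eval H f (push x (Inr s # w)) = (f (Inr s') \<otimes>\<^bsub>H\<^esub> f (Inl x')) \<otimes>\<^bsub>H\<^esub> word_eval H f w"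
        using 3[OF Some p[symmetric]] Some p f by (simp add: H.m_assoc)
      also have "\<dots> = (f (Inl x) \<otimes>\<^bsub>H\<^esub> f (Inr s)) \<otimes>\<^bsub>H\<^esub> word_eval H f w"
        using square[of x s s' x'] Some p by simp
      finally show ?thesis using f by (simp add: H.m_assoc)
    qed simp
  qed simp
  have act: "word_eval H f (act l w) = f l \<otimes>\<^bsub>H\<^esub> word_eval H f w" for l w
  proof (cases l)
    case (Inl x)
    then show ?thesis by (simp add: push)
  next
    case (Inr s)
    then show ?thesis using f by (cases w) (auto simp: inv' simp flip: H.m_assoc)
  qed
  show ?thesis
  proof (rule homI)
    fix u v assume "u \<in> carrier word_group" "v \<in> carrier word_group"
    show "word_eval H f (u \<bullet> v) = word_eval H f u \<otimes>\<^bsub>H\<^esub> word_eval H f v"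
      unfolding mult_word_group
    proof (induction u)
      case Nil
      have "word_eval H f [] = \<one>\<^bsub>H\<^esub>" by (simp add: word_eval_def)
      then show ?case by simp
    next
      case (Cons l u)
      then show ?case using f by (simp add: act H.m_assoc)
    qed
  qed simp
qed

lemma word_eval_single [simp]: "group H \<Longrightarrow> f l \<in> carrier H \<Longrightarrow> word_eval H f [l] = f l"
  using group.is_monoid[of H] by (simp add: word_eval_def monoid.r_one)

lemma word_group_hom_eqI:
  assumes H: "group H" and f: "f \<in> hom word_group H" and g: "g \<in> hom word_group H"
    and eq: "\<And>l. f [l] = g [l]" and w: "nf w"
  shows "f w = g w"
  using w
proof (induction w)
  case Nil
  then show ?case using hom_one[OF f Q.is_group H] hom_one[OF g Q.is_group H] by simp
next
  case (Cons l w)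
  then have w: "nf w" by (simp add: nf_Cons)
  have "[l] \<bullet> w = l # w" using act_Cons[OF Cons.prems] by (simp add: act_eq_mult)
  then show ?case
    using hom_mult[OF f, of "[l]" w] hom_mult[OF g, of "[l]" w] Cons.IH[OF w] eq w by simp
qed

end


section \<open>Meets and the four-point condition\<close>

context square_system
begin

lemma mult_Nil [simp]: "[] \<bullet> w = w"
  by (simp add: mult_word_group)

lemma qinv_Nil [simp]: "qinv [] = []"
  using Q.inv_one by simp

lemma qinv_mult_cancel: "nf u \<Longrightarrow> nf v \<Longrightarrow> nf w \<Longrightarrow> qinv (u \<bullet> v) \<bullet> (u \<bullet> w) = qinv v \<bullet> w"
  by (simp add: Q.inv_mult_group Q.m_assoc) (simp flip: Q.m_assoc)

lemma qinv_chain: "nf u \<Longrightarrow> nf v \<Longrightarrow> nf w \<Longrightarrow> (qinv u \<bullet> v) \<bullet> (qinv v \<bullet> w) = qinv u \<bullet> w"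
  by (simp add: Q.m_assoc) (simp flip: Q.m_assoc)

lemma length_qinv_mult_sym: "nf u \<Longrightarrow> nf v \<Longrightarrow> length (qinv u \<bullet> v) = length (qinv v \<bullet> u)"
  using length_qinv[of "qinv u \<bullet> v"] by (simp add: Q.inv_mult_group)

lemma length_triangle:
  assumes "nf u" "nf v" "nf w"
  shows "length (qinv u \<bullet> w) \<le> length (qinv u \<bullet> v) + length (qinv v \<bullet> w)"
  using length_mult_le[of "qinv u \<bullet> v" "qinv v \<bullet> w"] by (simp add: assms qinv_chain)

text \<open>\<open>p\<close> lies on a geodesic from the identity to \<open>y\<close>.\<close>

definition gprefix :: "('x letter + 's letter) list \<Rightarrow> ('x letter + 's letter) list \<Rightarrow> bool" where
  "gprefix p y \<longleftrightarrow> length y = length p + length (qinv p \<bullet> y)"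

text \<open>A geodesic for \<open>p\<close> followed by one for \<open>qinv p \<bullet> y\<close> is
  a geodesic for \<open>y\<close>, so its first letter can be stripped from both.\<close>

lemma descents_gprefix:
  assumes "nf p" "nf y" "gprefix p y" "l \<in> descents p"
  shows "l \<in> descents y" "gprefix ([inv_gen l] \<bullet> p) ([inv_gen l] \<bullet> y)"
proof -
  have e: "qinv ([inv_gen l] \<bullet> p) \<bullet> ([inv_gen l] \<bullet> y) = qinv p \<bullet> y"
    using assms by (simp add: qinv_mult_cancel)
  have "length ([inv_gen l] \<bullet> y) \<le> length ([inv_gen l] \<bullet> p) + length (qinv p \<bullet> y)"
    using length_mult_le[of "[inv_gen l] \<bullet> p" "qinv p \<bullet> y"] assms
    by (simp add: Q.m_assoc) (simp flip: Q.m_assoc)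
  then have "length ([inv_gen l] \<bullet> y) < length y"
    using assms by (simp add: gprefix_def descents_def)
  then show "l \<in> descents y" by (simp add: descents_def)
  then show "gprefix ([inv_gen l] \<bullet> p) ([inv_gen l] \<bullet> y)"
    using assms unfolding gprefix_def descents_iff e by simp
qed

text \<open>Stripping common descents as long as there are any builds \<open>m\<close>. By
  \<open>common_descent\<close> nothing cancels between the remainders, so \<open>length m\<close>
  is the Gromov product of \<open>g\<close> and \<open>h\<close> based at the identity.\<close>

lemma ex_meet:
  assumes "nf g" "nf h"
  obtains m where "nf m" "gprefix m g" "gprefix m h"
    "length (qinv g \<bullet> h) + 2 * length m = length g + length h"
proof -
  have "\<exists>m. nf m \<and> gprefix m g \<and> gprefix m h \<and>
          length (qinv g \<bullet> h) + 2 * length m = length g + length h"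
    using assms
  proof (induction "length g" arbitrary: g h rule: less_induct)
    case less
    show ?case
    proof (cases "descents g \<inter> descents h = {}")
      case True
      then have "length (qinv g \<bullet> h) = length g + length h"
        using common_descent[OF less.prems] length_mult_le[of "qinv g" h] length_qinv[of g] less.prems
        by fastforce
      then show ?thesis by (intro exI[of _ "[]"]) (simp add: gprefix_def)
    next
      case False
      then obtain l where l: "l \<in> descents g" "l \<in> descents h" by blast
      define g1 h1 where "g1 = [inv_gen l] \<bullet> g" and "h1 = [inv_gen l] \<bullet> h"
      have g1: "nf g1" "length g = Suc (length g1)" "g = [l] \<bullet> g1"
        using l less.prems by (auto simp: g1_def descents_iff)
      have h1: "nf h1" "length h = Suc (length h1)" "h = [l] \<bullet> h1"
        using l less.prems by (auto simp: h1_def descents_iff)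
      obtain m1 where m1: "nf m1" "gprefix m1 g1" "gprefix m1 h1"
          "length (qinv g1 \<bullet> h1) + 2 * length m1 = length g1 + length h1"
        using less.hyps[of g1 h1] g1 h1 by auto
      define m where "m = [l] \<bullet> m1"
      have m: "nf m" "length m \<le> Suc (length m1)"
        using m1 length_mult_le[of "[l]" m1] by (auto simp: m_def)
      have e: "qinv m \<bullet> g = qinv m1 \<bullet> g1" "qinv m \<bullet> h = qinv m1 \<bullet> h1" "qinv g \<bullet> h = qinv g1 \<bullet> h1"
        using m1 g1 h1 by (auto simp: m_def qinv_mult_cancel)
      \<comment> \<open>The triangle inequality excludes that \<open>l\<close> shortens
        \<open>m1\<close>.\<close>
      have "length g \<le> length m + length (qinv m \<bullet> g)"
        using length_triangle[of "[]" m g] m less.prems by simp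
      then have "length m = Suc (length m1)"
        using m m1(2) g1(2) by (simp add: e gprefix_def)
      then have "gprefix m g" "gprefix m h" "length (qinv g \<bullet> h) + 2 * length m = length g + length h"
        using m1 g1(2) h1(2) by (simp_all add: e gprefix_def)
      then show ?thesis using m by blast
    qed
  qed
  then show thesis using that by blast
qed

text \<open>The far side of the strip of squares in which \<open>s\<close> crosses the letters of \<open>xs\<close> one after another.\<close>

fun cross :: "'x letter list \<Rightarrow> 's letter \<Rightarrow> 'x letter list option" where
  "cross [] s = Some []"
| "cross (x # xs) s =
     (case sq x s of None \<Rightarrow> None | Some (s', x') \<Rightarrow> map_option ((#) x') (cross xs s'))"

lemma nf_map_Inl_Cons: "nf (map Inl (x # xs)) \<longleftrightarrow> nf (map Inl xs) \<and> (xs = [] \<or> hd xs \<noteq> inv_letter x)"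
  by (cases xs) (auto simp: nf_Cons)

lemma Inr_not_descent_map_Inl: "Inr s \<notin> descents (map Inl xs)"
  by (cases xs) (auto simp: Inr_in_descents_iff)

text \<open>The first letter of \<open>p\<close> is a descent of \<open>y\<close> other than
  \<open>s\<close>, hence an \<open>Inl\<close> letter spanning a square with \<open>s\<close>.
  Removing it leaves the same situation with the opposite rung, so \<open>s\<close> crosses all of
  \<open>p\<close>. Letters are inverted because the squares are read as
  \<open>x\<^sup>-\<^sup>1 s = s' x'\<^sup>-\<^sup>1\<close>.\<close>

lemma gprefix_crosses:
  assumes "nf p" "nf y" "gprefix p y" "Inr s \<in> descents y" "Inr s \<notin> descents p"
  shows "\<exists>xs ys. p = map Inl xs \<and> cross (map inv_letter xs) s = Some (map inv_letter ys) \<and>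
           nf (map Inl ys) \<and> gprefix (map Inl ys) ([inv_gen (Inr s)] \<bullet> y)"
  using assms
proof (induction p arbitrary: y s)
  case Nil
  then show ?case by (simp add: gprefix_def)
next
  case (Cons a p1)
  have p1: "nf p1" using Cons.prems by (simp add: nf_Cons)
  have p: "a # p1 = [a] \<bullet> p1" using act_Cons[OF Cons.prems(1)] by (simp add: act_eq_mult)
  have a: "a \<in> descents (a # p1)" using hd_in_descents Cons.prems(1) by blast
  have ay: "a \<in> descents y" "gprefix ([inv_gen a] \<bullet> (a # p1)) ([inv_gen a] \<bullet> y)"
    using descents_gprefix[OF Cons.prems(1-3) a] by auto
  obtain x where x: "a = Inl x"
    using ay(1) a Cons.prems(4,5) by (cases a) (auto simp: Inr_in_descents_iff)
  obtain s' x' where sq: "sq (inv_letter x) s = Some (s', inv_letter x')"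
    and comm: "[Inl x] \<bullet> [Inr s'] = [Inr s] \<bullet> [Inl x']"
    and s': "Inr s' \<in> descents ([inv_gen (Inl x)] \<bullet> y)"
    and x': "Inl x' \<in> descents ([inv_gen (Inr s)] \<bullet> y)"
    using descents_square[OF Cons.prems(2), of x s] ay(1) x Cons.prems(4) by metis
  define y1 where "y1 = [inv_gen a] \<bullet> y"
  have y1: "nf y1" "gprefix p1 y1" "Inr s' \<in> descents y1" "y = [a] \<bullet> y1" "Suc (length y1) = length y"
  proof -
    have "[inv_gen a] \<bullet> (a # p1) = p1" using p1 by (simp add: p)
    then show "gprefix p1 y1" using ay(2) by (simp add: y1_def)
    show "nf y1" "y = [a] \<bullet> y1" using Cons.prems(2) by (simp_all add: y1_def)
    show "Inr s' \<in> descents y1" using s' by (simp add: y1_def x)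
    show "Suc (length y1) = length y" using ay(1) by (simp add: y1_def descents_iff)
  qed
  \<comment> \<open>A head \<open>s'\<close> of \<open>p1\<close> would form a square with the
    preceding \<open>x\<close>, against normality of \<open>p\<close>.\<close>
  have "Inr s' \<notin> descents p1"
    using Cons.prems(1) sq_inv_left[OF sq] by (auto simp: Inr_in_descents_iff nf_Cons x)
  from Cons.IH[OF p1 y1(1-3) this] obtain xs ys where
    IH: "p1 = map Inl xs" "cross (map inv_letter xs) s' = Some (map inv_letter ys)"
      "nf (map Inl ys)" "gprefix (map Inl ys) ([inv_gen (Inr s')] \<bullet> y1)" by blast
  define y2 where "y2 = [inv_gen (Inr s')] \<bullet> y1"
  have y2: "nf y2" "Suc (length y2) = length y1" "y1 = [Inr s'] \<bullet> y2"
    using y1 by (auto simp: y2_def descents_iff simp del: inv_gen_simps)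
  define z where "z = [inv_gen (Inr s)] \<bullet> y"
  have z: "nf z" "Suc (length z) = length y"
    using Cons.prems by (auto simp: z_def descents_iff simp del: inv_gen_simps)
  have "y = [Inr s] \<bullet> ([Inl x'] \<bullet> y2)"
    using comm y1 y2 x by (simp flip: Q.m_assoc)
  then have zy2: "z = [Inl x'] \<bullet> y2" using y2(1) by (simp add: z_def del: inv_gen_simps)
  \<comment> \<open>The element \<open>z\<close> is one longer than \<open>y2\<close>, which forces
    \<open>x'\<close> to lengthen the prefix \<open>ys\<close>.\<close>
  have len: "length ([Inl x'] \<bullet> map Inl ys) = Suc (length ys)"
  proof -
    have "length z \<le> length ([Inl x'] \<bullet> map Inl ys) + length (qinv (map Inl ys) \<bullet> y2)"
      using length_mult_le[of "[Inl x'] \<bullet> map Inl ys" "qinv (map Inl ys) \<bullet> y2"] IH(3) y2(1)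
      by (simp add: zy2 Q.m_assoc) (simp flip: Q.m_assoc)
    moreover have "length y2 = length ys + length (qinv (map Inl ys) \<bullet> y2)"
      using IH(4) by (simp add: y2_def gprefix_def)
    ultimately show ?thesis
      using y2 z y1(5) length_act[of "Inl x'" "map Inl ys"] unfolding act_eq_mult by auto
  qed
  have nf: "nf (map Inl (x' # ys))"
  proof (cases ys)
    case (Cons z zs)
    have "z \<noteq> inv_letter x'"
      using len unfolding Cons by (auto simp: mult_word_group)
    then show ?thesis using IH(3) unfolding Cons nf_map_Inl_Cons by simp
  qed simp
  have e: "map Inl (x' # ys) = [Inl x'] \<bullet> map Inl ys"
    using act_Cons[of "Inl x'" "map Inl ys"] nf by (simp add: act_eq_mult)
  have "qinv ([Inl x'] \<bullet> map Inl ys) \<bullet> z = qinv (map Inl ys) \<bullet> y2"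
    unfolding zy2 using IH(3) y2(1) by (simp add: qinv_mult_cancel)
  moreover have "length y2 = length ys + length (qinv (map Inl ys) \<bullet> y2)"
    using IH(4) by (simp add: y2_def gprefix_def)
  ultimately have "gprefix (map Inl (x' # ys)) z"
    unfolding gprefix_def e len using y2(2) z(2) y1(5) by simp
  then show ?case
    using nf sq IH x by (intro exI[of _ "x # xs"] exI[of _ "x' # ys"]) (simp add: z_def)
qed

lemma nf_map_inv_letter: "nf (map Inl xs) \<Longrightarrow> nf (map Inl (map inv_letter xs))"
proof (induction xs)
  case (Cons x xs)
  then show ?case by (cases xs) (auto simp: nf_map_Inl_Cons simp del: list.map(2) map_map simp: list.map(2)[of inv_letter])
qed simp

end

text \<open>No flat rectangle of width two is longer than \<open>N\<close>.\<close>

locale thin_square_system = square_system sq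
  for sq :: "'x letter \<Rightarrow> 's letter \<Rightarrow> ('s letter \<times> 'x letter) option" +
  fixes N :: nat
  assumes strip_bound: "\<lbrakk>nf (map Inl xs); cross xs s = Some ys; cross ys t = Some zs; t \<noteq> inv_letter s\<rbrakk>
      \<Longrightarrow> length xs \<le> N"
    and N_pos: "N > 0"
begin

text \<open>The rung \<open>s\<close> crosses all of \<open>p\<close>. If the second letter of
  \<open>q\<close> is a rung, it crosses the far side of that strip, and the rectangle bounds
  \<open>p\<close>. If it is an \<open>Inl\<close> letter, \<open>p\<close> and \<open>q\<close>
  share a descent.\<close>

lemma divergent_prefixes:
  assumes nf: "nf p" "nf q" "nf y" and pre: "gprefix p y" "gprefix q y"
    and x: "Inl x \<in> descents p" and s: "Inr s \<in> descents q"
    and disj: "descents p \<inter> descents q = {}"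
  shows "length p \<le> N \<or> length q \<le> 1"
proof -
  have sy: "Inr s \<in> descents y" using descents_gprefix(1)[OF nf(2,3) pre(2) s] .
  obtain xs ys where xs: "p = map Inl xs" "cross (map inv_letter xs) s = Some (map inv_letter ys)"
      "nf (map Inl ys)" and ys: "gprefix (map Inl ys) ([inv_gen (Inr s)] \<bullet> y)"
    using gprefix_crosses[OF nf(1,3) pre(1) sy] s disj by blast
  obtain q1 where q1: "q = Inr s # q1" using s by (cases q) (auto simp: Inr_in_descents_iff)
  define y1 where "y1 = [inv_gen (Inr s)] \<bullet> y"
  have y1: "nf y1" using nf by (simp add: y1_def)
  have nq1: "nf q1" using nf q1 by (simp add: nf_Cons)
  have q1y1: "gprefix q1 y1"
    using descents_gprefix(2)[OF nf(2,3) pre(2) s] q1 by (simp add: y1_def mult_word_group)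
  show ?thesis
  proof (cases q1)
    case Nil
    then show ?thesis using q1 by simp
  next
    case (Cons a q2)
    have a: "a \<in> descents y1"
      using descents_gprefix(1)[OF nq1 y1 q1y1] hd_in_descents[of a q2] nq1 Cons by simp
    show ?thesis
    proof (cases a)
      case (Inr t)
      have t: "t \<noteq> inv_letter s" using nf(2) by (simp add: q1 Cons Inr nf_Cons)
      have "Inr t \<in> descents y1" using a Inr by simp
      then obtain xs' zs where "map Inl ys = (map Inl xs' :: ('x letter + 's letter) list)"
          and zs: "cross (map inv_letter xs') t = Some (map inv_letter zs)"
        using gprefix_crosses[OF xs(3) y1 _ _ Inr_not_descent_map_Inl, of t] ys unfolding y1_def by blast
      then have "xs' = ys" by (simp add: inj_map_eq_map)
      moreover have "nf (map Inl (map inv_letter xs))"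
        using nf_map_inv_letter nf(1) xs(1) by blast
      ultimately have "length (map inv_letter xs) \<le> N"
        using strip_bound[OF _ xs(2)] zs t by blast
      then show ?thesis by (simp add: xs(1))
    next
      case (Inl z)
      obtain x1 xs' where x1: "xs = x1 # xs'"
        using x xs(1) by (cases xs) (auto simp: descents_def)
      obtain s1 x' where sq: "sq (inv_letter x1) s = Some (s1, inv_letter x')" and x': "ys \<noteq> []" "hd ys = x'"
        using xs(2) by (cases ys) (auto simp: x1 split: option.splits)
      have "Inl x' \<in> descents (map Inl ys)"
        using hd_in_descents[of "Inl x'" "map Inl (tl ys)"] xs(3) x' by (cases ys) auto
      then have "Inl x' \<in> descents y1"
        using descents_gprefix(1)[OF xs(3) y1] ys by (simp add: y1_def)
      \<comment> \<open>Both are the \<open>Inl\<close> descent of \<open>y1\<close>. So the second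
        letter of \<open>q\<close> closes the first square of the strip, and \<open>x1\<close> is a
        descent of \<open>q\<close> as well.\<close>
      then have "z = x'" using a Inl Inl_descent_unique by blast
      then have "Inl x1 \<in> descents q"
        using sq by (simp add: descents_def q1 Cons Inl mult_word_group)
      moreover have "Inl x1 \<in> descents p"
        using hd_in_descents[of "Inl x1" "map Inl xs'"] nf(1) by (simp add: xs x1)
      ultimately show ?thesis using disj by blast
    qed
  qed
qed

text \<open>Equivalently, the distance of \<open>p\<close> and \<open>q\<close> exceeds the
  difference of their lengths by at most \<open>2 * N\<close>. Removing a common descent lowers both
  sides by two; without one, \<open>p\<close> or \<open>q\<close> has length at most
  \<open>N\<close> and the triangle inequality suffices.\<close>

lemma prefixes_fellow_travel:
  assumes "nf p" "nf q" "nf y" "gprefix p y" "gprefix q y"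
  shows "length (qinv p \<bullet> q) + 2 * min (length p) (length q) \<le> length p + length q + 2 * N"
  using assms
proof (induction "length p" arbitrary: p q y rule: less_induct)
  case less
  have le: "length (qinv p \<bullet> q) \<le> length p + length q"
    using length_mult_le[of "qinv p" q] length_qinv[of p] less.prems by simp
  show ?case
  proof (cases "descents p \<inter> descents q = {}")
    case False
    then obtain l where l: "l \<in> descents p" "l \<in> descents q" by blast
    define p1 q1 y1 where "p1 = [inv_gen l] \<bullet> p" and "q1 = [inv_gen l] \<bullet> q" and "y1 = [inv_gen l] \<bullet> y"
    have nf: "nf p1" "nf q1" "nf y1"
      using less.prems(1-3) by (simp_all add: p1_def q1_def y1_def)
    have pre: "gprefix p1 y1" "gprefix q1 y1"
      unfolding p1_def q1_def y1_def
      using descents_gprefix(2)[OF less.prems(1,3,4) l(1)] descents_gprefix(2)[OF less.prems(2,3,5) l(2)] .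
    have len: "length p = Suc (length p1)" "length q = Suc (length q1)"
      using l unfolding p1_def q1_def descents_iff by metis+
    have "length (qinv p1 \<bullet> q1) + 2 * min (length p1) (length q1) \<le> length p1 + length q1 + 2 * N"
      by (rule less.hyps[OF _ nf pre]) (simp add: len)
    moreover have "qinv p1 \<bullet> q1 = qinv p \<bullet> q"
      using less.prems(1,2) by (simp add: p1_def q1_def qinv_mult_cancel)
    ultimately show ?thesis unfolding len by simp
  next
    case True
    have "length p \<le> N \<or> length q \<le> N"
    proof (cases "p = [] \<or> q = []")
      case False
      obtain a p' b q' where pq: "p = a # p'" "q = b # q'"
        using False by (cases p; cases q) auto
      have a: "a \<in> descents p" and b: "b \<in> descents q"
        using hd_in_descents less.prems(1,2) unfolding pq by blast+
      have y: "a \<in> descents y" "b \<in> descents y" "a \<noteq> b"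
        using descents_gprefix(1)[OF less.prems(1,3,4) a] descents_gprefix(1)[OF less.prems(2,3,5) b] a b True
        by auto
      show ?thesis
      proof (cases a)
        case (Inl x)
        then obtain s where s: "b = Inr s" using y Inl_descent_unique by (cases b) auto
        have "length p \<le> N \<or> length q \<le> 1"
          using divergent_prefixes[OF less.prems a[unfolded Inl] b[unfolded s] True] .
        then show ?thesis using N_pos by linarith
      next
        case (Inr s)
        then obtain x where x: "b = Inl x" using y by (cases b) (auto simp: Inr_in_descents_iff)
        have "length q \<le> N \<or> length p \<le> 1"
          using divergent_prefixes[OF less.prems(2,1,3,5,4) b[unfolded x] a[unfolded Inr]] True
          by (simp add: Int_commute)
        then show ?thesis using N_pos by linarith
      qed
    qed auto
    then have "min (length p) (length q) \<le> N" by (simp add: min_le_iff_disj)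
    then show ?thesis using le by linarith
  qed
qed

text \<open>Twice the Gromov product based at the identity, which keeps the argument in the
  integers.\<close>

definition gp :: "('x letter + 's letter) list \<Rightarrow> ('x letter + 's letter) list \<Rightarrow> int" where
  "gp x y = int (length x) + int (length y) - int (length (qinv x \<bullet> y))"

text \<open>The meets \<open>p\<close> of \<open>x\<close>, \<open>y\<close> and \<open>q\<close> of
  \<open>y\<close>, \<open>z\<close> are both prefixes of \<open>y\<close>, so they fellow-travel.
  Going from \<open>x\<close> to \<open>z\<close> through \<open>p\<close> and \<open>q\<close>
  bounds the distance by \<open>|x| + |z| - 2 min(|p|, |q|) + 2 N\<close>.\<close>

lemma four_point:
  assumes "nf x" "nf y" "nf z"
  shows "min (gp x y) (gp y z) \<le> gp x z + 2 * int N"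
proof -
  obtain p where p: "nf p" "gprefix p x" "gprefix p y"
      "length (qinv x \<bullet> y) + 2 * length p = length x + length y"
    by (rule ex_meet[OF assms(1,2)])
  obtain q where q: "nf q" "gprefix q y" "gprefix q z"
      "length (qinv y \<bullet> z) + 2 * length q = length y + length z"
    by (rule ex_meet[OF assms(2,3)])
  have 1: "length (qinv p \<bullet> q) + 2 * min (length p) (length q) \<le> length p + length q + 2 * N"
    using prefixes_fellow_travel[OF p(1) q(1) assms(2) p(3) q(2)] .
  have 2: "length (qinv x \<bullet> z) \<le> length (qinv x \<bullet> p) + length (qinv p \<bullet> q) + length (qinv q \<bullet> z)"
    using length_triangle[OF assms(1) p(1) assms(3)] length_triangle[OF p(1) q(1) assms(3)] by linarith
  have 3: "length (qinv x \<bullet> p) = length (qinv p \<bullet> x)"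
    by (rule length_qinv_mult_sym[OF assms(1) p(1)])
  have 4: "length x = length p + length (qinv p \<bullet> x)" "length z = length q + length (qinv q \<bullet> z)"
    using p(2) q(3) by (simp_all add: gprefix_def)
  have "gp x y = 2 * int (length p)" "gp y z = 2 * int (length q)"
    using p(4) q(4) by (simp_all add: gp_def)
  moreover have "2 * int (length p) \<le> gp x z + 2 * int N \<or> 2 * int (length q) \<le> gp x z + 2 * int N"
  proof (cases "length p \<le> length q")
    case True
    then show ?thesis using 1 2 3 4 by (simp add: gp_def)
  next
    case False
    then show ?thesis using 1 2 3 4 by (simp add: gp_def)
  qed
  ultimately show ?thesis by (simp add: min_le_iff_disj)
qed

section \<open>The word metric of the letters\<close>

lemma generate_letters: "generate word_group (range (\<lambda>l. [l])) = carrier word_group"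
proof
  show "generate word_group (range (\<lambda>l. [l])) \<subseteq> carrier word_group"
    by (rule Q.generate_incl) auto
  show "carrier word_group \<subseteq> generate word_group (range (\<lambda>l. [l]))"
  proof
    fix w assume "w \<in> carrier word_group"
    then have "nf w" by simp
    then show "w \<in> generate word_group (range (\<lambda>l. [l]))"
    proof (induction w)
      case Nil
      then show ?case using generate.one[of word_group] by simp
    next
      case (Cons l w)
      then have "[l] \<bullet> w \<in> generate word_group (range (\<lambda>l. [l]))"
        by (intro generate.eng) (auto intro: generate.incl simp: nf_Cons)
      then show ?case using act_Cons[OF Cons.prems] by (simp add: act_eq_mult)
    qed
  qed
qed

text \<open>Normal forms are geodesic, because a letter adds at most one to the length. The set of
  letters is already closed under inversion.\<close>

lemma word_length_letters:
  assumes "nf w"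
  shows "word_length word_group (range (\<lambda>l. [l])) w = length w"
proof -
  let ?T = "range (\<lambda>l. [l]) \<union> m_inv word_group ` range (\<lambda>l. [l])"
  have T: "?T = range (\<lambda>l. [l])" by auto
  have le: "length (foldr (monoid.mult word_group) ws []) \<le> length ws" if "set ws \<subseteq> range (\<lambda>l. [l])" for ws
    using that
  proof (induction ws)
    case (Cons a ws)
    then show ?case using length_mult_le[of a "foldr (monoid.mult word_group) ws []"] by auto
  qed simp
  have ex: "foldr (monoid.mult word_group) (map (\<lambda>l. [l]) w) [] = w" if "nf w" for w
    using that
  proof (induction w)
    case (Cons l w)
    then show ?case using act_Cons[of l w] by (simp add: nf_Cons act_eq_mult)
  qed simp
  show ?thesis
    unfolding word_length_def T
  proof (rule Least_equality)
    show "\<exists>ws. length ws = length w \<and> set ws \<subseteq> range (\<lambda>l. [l]) \<and>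
        foldr (monoid.mult word_group) ws \<one>\<^bsub>word_group\<^esub> = w"
      using ex[OF assms] by (intro exI[of _ "map (\<lambda>l. [l]) w"]) auto
  qed (use le in auto)
qed

lemma word_dist_letters:
  "nf g \<Longrightarrow> nf h \<Longrightarrow> word_dist word_group (range (\<lambda>l. [l])) g h = real (length (qinv g \<bullet> h))"
  by (simp add: word_dist_def word_length_letters)

lemma gromov_product_letters:
  assumes "nf w" "nf x" "nf y"
  shows "gromov_product (word_dist word_group (range (\<lambda>l. [l]))) w x y = real_of_int (gp (qinv w \<bullet> x) (qinv w \<bullet> y)) / 2"
  using assms length_qinv_mult_sym[of w]
  by (simp add: gromov_product_def word_dist_letters gp_def qinv_mult_cancel)

lemma hyperbolic_word_group:
  assumes "finite (UNIV :: 'x set)" "finite (UNIV :: 's set)"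
  shows "hyperbolic_group word_group"
proof -
  let ?S = "range (\<lambda>l. [l]) :: ('x letter + 's letter) list set"
  have "finite (UNIV :: ('x letter + 's letter) set)"
    using assms by (simp add: finite_Plus_UNIV_iff finite_prod)
  then have "finite ?S" by simp
  moreover have "gromov_hyperbolic_on (carrier word_group) (word_dist word_group ?S)"
    unfolding gromov_hyperbolic_on_def
  \<comment> \<open>As \<open>gp\<close> is twice the Gromov product, the error \<open>2 * N\<close>
    of \<open>four_point\<close> becomes \<delta> = \<open>N\<close>.\<close>
  proof (intro exI[of _ "real N"] conjI ballI)
    fix w x y z
    assume "w \<in> carrier word_group" "x \<in> carrier word_group" "y \<in> carrier word_group" "z \<in> carrier word_group"
    then have nf: "nf w" "nf x" "nf y" "nf z" by auto
    let ?a = "gp (qinv w \<bullet> x) (qinv w \<bullet> y)" and ?b = "gp (qinv w \<bullet> y) (qinv w \<bullet> z)"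
      and ?c = "gp (qinv w \<bullet> x) (qinv w \<bullet> z)"
    have "min ?a ?b \<le> ?c + 2 * int N"
      by (intro four_point nf_mult nf_qinv nf)
    then have "?a \<le> ?c + 2 * int N \<or> ?b \<le> ?c + 2 * int N"
      by (simp only: min_le_iff_disj)
    moreover have "real_of_int k / 2 - real N \<le> real_of_int m / 2" if "k \<le> m + 2 * int N" for k m
      using that by linarith
    ultimately have "real_of_int ?a / 2 - real N \<le> real_of_int ?c / 2 \<or> real_of_int ?b / 2 - real N \<le> real_of_int ?c / 2"
      by blast
    moreover have "min s t - u \<le> v" if "s - u \<le> v \<or> t - u \<le> v" for s t u v :: real
      using that by (auto simp: min_def)
    ultimately have "min (real_of_int ?a / 2) (real_of_int ?b / 2) - real N \<le> real_of_int ?c / 2"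
      by blast
    then show "min (gromov_product (word_dist word_group ?S) w x y) (gromov_product (word_dist word_group ?S) w y z) - real N
        \<le> gromov_product (word_dist word_group ?S) w x z"
      unfolding gromov_product_letters[OF nf(1,2,3)] gromov_product_letters[OF nf(1,3,4)]
        gromov_product_letters[OF nf(1,2,4)] .
  qed simp
  moreover have "?S \<subseteq> carrier word_group" by auto
  ultimately show ?thesis
    unfolding hyperbolic_group_def using generate_letters Q.is_group by blast
qed

end

section \<open>The group\<close>

datatype rung = S0 | S1 | S2 | S3

text \<open>
  The letters \<open>x\<close> and \<open>y\<close> are \<open>False\<close> and \<open>True\<close>. An edge \<open>rung_pred z s = Some r\<close> stands for the
  relation \<open>z s = r z'\<close>, where \<open>z'\<close> is the other letter.
\<close>

fun rung_pred :: "bool \<Rightarrow> rung \<Rightarrow> rung option" where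
  "rung_pred True S0 = Some S0"
| "rung_pred False S1 = Some S0"
| "rung_pred True S2 = Some S1"
| "rung_pred False S3 = Some S2"
| "rung_pred False S0 = Some S3"
| "rung_pred _ _ = None"

fun rung_succ :: "bool \<Rightarrow> rung \<Rightarrow> rung option" where
  "rung_succ True S0 = Some S0"
| "rung_succ False S0 = Some S1"
| "rung_succ True S1 = Some S2"
| "rung_succ False S2 = Some S3"
| "rung_succ False S3 = Some S0"
| "rung_succ _ _ = None"

text \<open>All four readings of the squares \<open>z s = r z'\<close>. Inverting the letter
  exchanges \<open>rung_pred\<close> and \<open>rung_succ\<close>; inverting the rung exchanges
  \<open>z\<close> and \<open>z'\<close>, which the test \<open>z = e\<close> accounts for.\<close>

definition rung_sq :: "bool letter \<Rightarrow> rung letter \<Rightarrow> (rung letter \<times> bool letter) option" where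
  "rung_sq = (\<lambda>(b, z) (e, s).
     map_option (\<lambda>r. ((e, r), (b, \<not> z))) (if b then rung_pred (z = e) s else rung_succ (z = e) s))"

lemma rung_succ_iff: "rung_succ z r = Some s \<longleftrightarrow> rung_pred z s = Some r"
  by (cases z; cases r; cases s) auto

interpretation R: square_system rung_sq
proof
  fix x s s' x' assume "rung_sq x s = Some (s', x')"
  then show "rung_sq (inv_letter x) s' = Some (s, inv_letter x')" "rung_sq x' (inv_letter s) = Some (inv_letter s', x)"
    by (cases x; cases s; auto simp: rung_sq_def inv_letter_def rung_succ_iff split: if_splits;
        auto simp flip: rung_succ_iff)+
qed

text \<open>
  \<open>double_strip n x s t\<close>: some reduced word of \<open>n + 1\<close> letters starting with \<open>x\<close> is crossed by \<open>s\<close> and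
  then by \<open>t\<close>.
\<close>

fun double_strip :: "nat \<Rightarrow> bool letter \<Rightarrow> rung letter \<Rightarrow> rung letter \<Rightarrow> bool" where
  "double_strip n x s t \<longleftrightarrow> (case rung_sq x s of None \<Rightarrow> False | Some (s', x') \<Rightarrow>
     (case rung_sq x' t of None \<Rightarrow> False | Some (t', _) \<Rightarrow>
       (case n of 0 \<Rightarrow> True | Suc m \<Rightarrow>
         list_ex (\<lambda>z. z \<noteq> inv_letter x \<and> double_strip m z s' t')
           [(True, True), (True, False), (False, True), (False, False)])))"

declare double_strip.simps [simp del]

text \<open>Reduces strips of any greater length to a finite search, whose state is the current
  letter and the two rungs that cross it.\<close>

lemma double_stripI:
  assumes "R.nf (map Inl (x # xs))" "R.cross (x # xs) s = Some ys" "R.cross ys t = Some zs" "n \<le> length xs"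
  shows "double_strip n x s t"
  using assms
proof (induction n arbitrary: x xs s t ys zs)
  case 0
  then show ?case
    by (subst double_strip.simps) (auto split: option.splits)
next
  case (Suc n)
  obtain z xs' where xs: "xs = z # xs'" using Suc.prems(4) by (cases xs) auto
  obtain s' x' ys' where 1: "rung_sq x s = Some (s', x')" "R.cross xs s' = Some ys'" "ys = x' # ys'"
    using Suc.prems(2) by (auto split: option.splits)
  obtain t' x'' zs' where 2: "rung_sq x' t = Some (t', x'')" "R.cross ys' t' = Some zs'"
    using Suc.prems(3) 1(3) by (auto split: option.splits)
  have "R.nf (map Inl (z # xs'))" using Suc.prems(1) xs by (simp add: R.nf_Cons)
  then have "double_strip n z s' t'"
    using Suc.IH[of z xs' s' ys' t' zs'] Suc.prems(4) 1(2) 2(2) xs by simp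
  moreover have "z \<noteq> inv_letter x" using Suc.prems(1) xs by (simp add: R.nf_Cons)
  moreover have "z \<in> set [(True, True), (True, False), (False, True), (False, False)]"
    by (cases z) auto
  ultimately have "list_ex (\<lambda>z. z \<noteq> inv_letter x \<and> double_strip n z s' t')
      [(True, True), (True, False), (False, True), (False, False)]"
    unfolding list_ex_iff by blast
  then show ?case
    using 1(1) 2(1) by (subst double_strip.simps) simp
qed

lemma no_long_double_strip: "t \<noteq> inv_letter s \<Longrightarrow> \<not> double_strip 6 x s t"
proof -
  \<comment> \<open>The argument 6 stands for words of seven letters. All \<open>4 * 8 * 8\<close>
    starting configurations are checked by evaluation.\<close>
  have "list_all (\<lambda>x. list_all (\<lambda>s. list_all (\<lambda>t. t = inv_letter s \<or> \<not> double_strip 6 x s t)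
      (List.product [True, False] [S0, S1, S2, S3])) (List.product [True, False] [S0, S1, S2, S3]))
      (List.product [True, False] [True, False])"
    by code_simp
  moreover have "x \<in> set (List.product [True, False] [True, False])" by (cases x) auto
  moreover have "r \<in> set (List.product [True, False] [S0, S1, S2, S3])" for r
    by (cases r; cases "snd r") auto
  ultimately show "t \<noteq> inv_letter s \<Longrightarrow> \<not> double_strip 6 x s t"
    unfolding list_all_iff by blast
qed

interpretation R: thin_square_system rung_sq 6
proof
  fix xs :: "bool letter list" and s t :: "rung letter" and ys zs
  assume "R.nf (map Inl xs)" "R.cross xs s = Some ys" "R.cross ys t = Some zs" "t \<noteq> inv_letter s"
  then have "double_strip 6 (hd xs) s t" if "length xs > 6"
    using double_stripI[of "hd xs" "tl xs" s ys t zs 6] that by (cases xs) auto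
  then show "length xs \<le> 6"
    using no_long_double_strip[OF \<open>t \<noteq> inv_letter s\<close>] by (meson not_le_imp_less)
qed simp

text \<open>The squares \<open>x S1 = S0 y\<close>, \<open>y S2 = S1 x\<close> and
  \<open>x S3 = S2 y\<close>, solved for \<open>S1\<close>, \<open>S2\<close> and \<open>S3\<close>.
  The remaining two squares are the relators.\<close>

fun rung_val :: "('b, 'c) monoid_scheme \<Rightarrow> 'b \<Rightarrow> 'b \<Rightarrow> 'b \<Rightarrow> rung \<Rightarrow> 'b" where
  "rung_val H x y t S0 = t"
| "rung_val H x y t S1 = inv\<^bsub>H\<^esub> x \<otimes>\<^bsub>H\<^esub> (t \<otimes>\<^bsub>H\<^esub> y)"
| "rung_val H x y t S2 = inv\<^bsub>H\<^esub> y \<otimes>\<^bsub>H\<^esub> ((inv\<^bsub>H\<^esub> x \<otimes>\<^bsub>H\<^esub> (t \<otimes>\<^bsub>H\<^esub> y)) \<otimes>\<^bsub>H\<^esub> x)"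
| "rung_val H x y t S3 = inv\<^bsub>H\<^esub> x \<otimes>\<^bsub>H\<^esub> ((inv\<^bsub>H\<^esub> y \<otimes>\<^bsub>H\<^esub> ((inv\<^bsub>H\<^esub> x \<otimes>\<^bsub>H\<^esub> (t \<otimes>\<^bsub>H\<^esub> y)) \<otimes>\<^bsub>H\<^esub> x)) \<otimes>\<^bsub>H\<^esub> y)"

fun gen_val :: "('b, 'c) monoid_scheme \<Rightarrow> 'b \<Rightarrow> 'b \<Rightarrow> 'b \<Rightarrow> bool letter + rung letter \<Rightarrow> 'b" where
  "gen_val H x y t (Inl (True, z)) = (if z then y else x)"
| "gen_val H x y t (Inl (False, z)) = inv\<^bsub>H\<^esub> (if z then y else x)"
| "gen_val H x y t (Inr (True, s)) = rung_val H x y t s"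
| "gen_val H x y t (Inr (False, s)) = inv\<^bsub>H\<^esub> rung_val H x y t s"

lemma gen_val_hom:
  assumes "group G" "group H" "f \<in> hom G H" "x \<in> carrier G" "y \<in> carrier G" "t \<in> carrier G"
  shows "f (gen_val G x y t l) = gen_val H (f x) (f y) (f t) l"
proof -
  interpret G: group G by fact
  interpret f: group_hom G H f
    using assms by (simp add: group_hom_def group_hom_axioms_def)
  have r: "rung_val G x y t s \<in> carrier G" "f (rung_val G x y t s) = rung_val H (f x) (f y) (f t) s" for s
    using assms(4-6) by (cases s; simp)+
  show ?thesis
    using assms(4-6) by (cases "(G, x, y, t, l)" rule: gen_val.cases) (simp_all add: r)
qed

lemma (in group) square_inverses:
  assumes "a \<in> carrier G" "b \<in> carrier G" "r \<in> carrier G" "s \<in> carrier G" and eq: "a \<otimes> s = r \<otimes> b"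
  shows "inv a \<otimes> r = s \<otimes> inv b" "b \<otimes> inv s = inv r \<otimes> a" "inv b \<otimes> inv r = inv s \<otimes> inv a"
proof -
  have "a \<otimes> s \<otimes> inv b = r \<otimes> b \<otimes> inv b" "inv r \<otimes> (a \<otimes> s) = inv r \<otimes> (r \<otimes> b)"
    using eq by simp_all
  then have r: "r = a \<otimes> (s \<otimes> inv b)" and b: "b = inv r \<otimes> (a \<otimes> s)"
    using assms(1-4) by (simp_all add: m_assoc) (simp flip: m_assoc)
  have "inv a \<otimes> r = inv a \<otimes> (a \<otimes> (s \<otimes> inv b))" by (subst r) (rule refl)
  then show "inv a \<otimes> r = s \<otimes> inv b"
    using assms(1-4) by (simp flip: m_assoc)
  have "b \<otimes> inv s = inv r \<otimes> (a \<otimes> s) \<otimes> inv s" by (subst b) (rule refl)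
  then show "b \<otimes> inv s = inv r \<otimes> a"
    using assms(1-4) by (simp add: m_assoc)
  have "inv (a \<otimes> s) = inv (r \<otimes> b)" using eq by simp
  then show "inv b \<otimes> inv r = inv s \<otimes> inv a"
    using assms(1-4) by (simp add: inv_mult_group)
qed

lemma (in group) mult_cong_left:
  assumes "a \<otimes> b = c \<otimes> d" "a \<in> carrier G" "b \<in> carrier G" "c \<in> carrier G" "d \<in> carrier G" "w \<in> carrier G"
  shows "a \<otimes> (b \<otimes> w) = c \<otimes> (d \<otimes> w)"
  using assms by (simp flip: m_assoc)

text \<open>Positive squares follow from the choice of the rungs and the two relators; other signs
  are the same squares read from another corner, by \<open>square_inverses\<close>.\<close>

lemma (in group) gen_val_square:
  assumes c [simp]: "x \<in> carrier G" "y \<in> carrier G" "t \<in> carrier G"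
    and yt: "y \<otimes> t = t \<otimes> x"
    and rel: "x \<otimes> (y \<otimes> (x \<otimes> (x \<otimes> t))) = t \<otimes> (y \<otimes> (x \<otimes> (y \<otimes> y)))"
    and sq: "rung_sq k l = Some (l', k')"
  shows "gen_val G x y t (Inl k) \<otimes> gen_val G x y t (Inr l) = gen_val G x y t (Inr l') \<otimes> gen_val G x y t (Inl k')"
proof -
  let ?v = "\<lambda>z. if z then y else x"
  have r [simp]: "rung_val G x y t s \<in> carrier G" for s
    by (cases s) simp_all
  \<comment> \<open>The fifth square is the long relator, once \<open>S3\<close> is
    expanded.\<close>
  have close: "x \<otimes> t = rung_val G x y t S3 \<otimes> y"
  proof -
    have "rung_val G x y t S3 \<otimes> y = inv x \<otimes> (inv y \<otimes> (inv x \<otimes> (x \<otimes> (y \<otimes> (x \<otimes> (x \<otimes> t))))))"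
      unfolding rel by (simp add: m_assoc)
    also have "\<dots> = x \<otimes> t" by (simp flip: m_assoc)
    finally show ?thesis by simp
  qed
  have pos: "?v z \<otimes> rung_val G x y t s = rung_val G x y t r \<otimes> ?v (\<not> z)" if "rung_pred z s = Some r" for z s r
  proof -
    have cancel: "x \<otimes> (inv x \<otimes> w) = w" "y \<otimes> (inv y \<otimes> w) = w" if "w \<in> carrier G" for w
      using that by (simp_all flip: m_assoc)
    have "y \<otimes> rung_val G x y t S0 = rung_val G x y t S0 \<otimes> x" "x \<otimes> rung_val G x y t S1 = rung_val G x y t S0 \<otimes> y"
      "y \<otimes> rung_val G x y t S2 = rung_val G x y t S1 \<otimes> x" "x \<otimes> rung_val G x y t S3 = rung_val G x y t S2 \<otimes> y"
      "x \<otimes> rung_val G x y t S0 = rung_val G x y t S3 \<otimes> y"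
      using yt close by (simp_all add: cancel)
    then show ?thesis
      using that by (cases z; cases s) (auto simp del: rung_val.simps)
  qed
  obtain b z where k: "k = (b, z)" by (cases k)
  obtain e s where l: "l = (e, s)" by (cases l)
  obtain p where p: "l' = (e, p)" "k' = (b, \<not> z)" and
      "(if b then rung_pred (z = e) s else rung_succ (z = e) s) = Some p"
    using sq by (auto simp: k l rung_sq_def)
  then have "if b then rung_pred (z = e) s = Some p else rung_pred (z = e) p = Some s"
    by (simp add: rung_succ_iff split: if_splits)
  then show ?thesis
    using pos[of "z = e" s p] pos[of "z = e" p s]
      square_inverses[of "?v (z = e)" "?v (z \<noteq> e)" "rung_val G x y t s" "rung_val G x y t p"]
      square_inverses[of "?v (z = e)" "?v (z \<noteq> e)" "rung_val G x y t p" "rung_val G x y t s"]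
    unfolding k l p by (cases b; cases e; cases z) simp_all
qed

lemma (in group) gen_val_word_hom:
  assumes "x \<in> carrier G" "y \<in> carrier G" "t \<in> carrier G" "y \<otimes> t = t \<otimes> x"
    and "x \<otimes> (y \<otimes> (x \<otimes> (x \<otimes> t))) = t \<otimes> (y \<otimes> (x \<otimes> (y \<otimes> y)))"
  shows "R.word_eval G (gen_val G x y t) \<in> hom R.word_group G"
    "R.word_eval G (gen_val G x y t) [l] = gen_val G x y t l"
proof -
  have r [simp]: "rung_val G x y t s \<in> carrier G" for s
    using assms by (cases s) simp_all
  have c: "gen_val G x y t l \<in> carrier G" for l
    using assms by (cases "(G, x, y, t, l)" rule: gen_val.cases) simp_all
  have i: "gen_val G x y t (inv_gen l) = inv gen_val G x y t l" for l
    using assms by (cases "(G, x, y, t, l)" rule: gen_val.cases) (simp_all add: inv_letter_def)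
  show "R.word_eval G (gen_val G x y t) \<in> hom R.word_group G"
    using gen_val_square[OF assms] c i by (intro R.word_eval_hom is_group)
  show "R.word_eval G (gen_val G x y t) [l] = gen_val G x y t l"
    using c is_group by simp
qed

text \<open>Conversely, both relators hold in \<open>R.word_group\<close> and the derived rungs are
  its letters. With \<open>gen_val_word_hom\<close> this identifies it with the presented
  group.\<close>

lemma gen_val_word_group:
  fixes x y t
  defines "x \<equiv> [Inl (True, False)]" and "y \<equiv> [Inl (True, True)]" and "t \<equiv> [Inr (True, S0)]"
  shows "gen_val R.word_group x y t l = [l]"
    "y \<otimes>\<^bsub>R.word_group\<^esub> t = t \<otimes>\<^bsub>R.word_group\<^esub> x"
    "x \<otimes>\<^bsub>R.word_group\<^esub> (y \<otimes>\<^bsub>R.word_group\<^esub> (x \<otimes>\<^bsub>R.word_group\<^esub> (x \<otimes>\<^bsub>R.word_group\<^esub> t)))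
      = t \<otimes>\<^bsub>R.word_group\<^esub> (y \<otimes>\<^bsub>R.word_group\<^esub> (x \<otimes>\<^bsub>R.word_group\<^esub> (y \<otimes>\<^bsub>R.word_group\<^esub> y)))"
proof -
  let ?Q = R.word_group
  let ?v = "\<lambda>z. [Inl (True, z)] :: (bool letter + rung letter) list"
  let ?r = "\<lambda>s. [Inr (True, s)] :: (bool letter + rung letter) list"
  have sq: "?v z \<otimes>\<^bsub>?Q\<^esub> ?r s = ?r p \<otimes>\<^bsub>?Q\<^esub> ?v (\<not> z)" if "rung_pred z s = Some p" for z s p
  proof -
    have "rung_sq (True, z) (True, s) = Some ((True, p), (True, \<not> z))"
      using that by (simp add: rung_sq_def)
    then show ?thesis by (simp add: R.mult_word_group)
  qed
  have solve: "?r s = inv\<^bsub>?Q\<^esub> ?v z \<otimes>\<^bsub>?Q\<^esub> (?r p \<otimes>\<^bsub>?Q\<^esub> ?v (\<not> z))" if "rung_pred z s = Some p" for z s p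
    using R.inv_gen_mult_cancel(2)[of "?r s" "Inl (True, z)"] by (simp flip: sq[OF that])
  have rung: "rung_val ?Q x y t s = ?r s" for s
    using solve[of False S1 S0] solve[of True S2 S1] solve[of False S3 S2]
    by (cases s) (simp_all add: x_def y_def t_def)
  show "gen_val ?Q x y t l = [l]"
    by (cases "(?Q, x, y, t, l)" rule: gen_val.cases)
      (auto simp: rung[unfolded x_def y_def] x_def y_def inv_letter_def)
  show "y \<otimes>\<^bsub>?Q\<^esub> t = t \<otimes>\<^bsub>?Q\<^esub> x"
    using sq[of True S0 S0] by (simp add: x_def y_def t_def)
  have nf [simp]: "R.nf x" "R.nf y" "R.nf t" by (simp_all add: x_def y_def t_def)
  note sq0 = sq[of True S0 S0, simplified] sq[of False S0 S3, simplified] sq[of False S3 S2, simplified]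
    sq[of True S2 S1, simplified] sq[of False S1 S0, simplified]
  show "x \<otimes>\<^bsub>?Q\<^esub> (y \<otimes>\<^bsub>?Q\<^esub> (x \<otimes>\<^bsub>?Q\<^esub> (x \<otimes>\<^bsub>?Q\<^esub> t))) = t \<otimes>\<^bsub>?Q\<^esub> (y \<otimes>\<^bsub>?Q\<^esub> (x \<otimes>\<^bsub>?Q\<^esub> (y \<otimes>\<^bsub>?Q\<^esub> y)))"
    by (simp add: x_def y_def t_def sq0 R.Q.mult_cong_left[OF sq0(3)] R.Q.mult_cong_left[OF sq0(4)]
        R.Q.mult_cong_left[OF sq0(5)])
qed

section \<open>Free kernels of growing rank\<close>

text \<open>Substitute \<open>x = a\<^sub>0 c\<^sup>k\<close> and
  \<open>y = a\<^sub>1 c\<^sup>k\<close> in the long relator and collect the powers of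
  \<open>c\<close> on the right: both sides end in the power with exponent \<open>4 * k + 1\<close>,
  which cancels.\<close>

lemma (in group) conj_relation:
  fixes k :: int
  assumes [simp]: "x \<in> carrier G" "c \<in> carrier G"
    and yc: "y \<otimes> c = c \<otimes> x" and [simp]: "y \<in> carrier G"
    and rel: "x \<otimes> (y \<otimes> (x \<otimes> (x \<otimes> c))) = c \<otimes> (y \<otimes> (x \<otimes> (y \<otimes> y)))"
  defines "a \<equiv> \<lambda>i::int. c [^] i \<otimes> (x \<otimes> c [^] (- k - i))"
  shows "a i \<in> carrier G" "a (i + 1) \<otimes> c = c \<otimes> a i" "a 0 \<otimes> c [^] k = x" "a 1 \<otimes> c [^] k = y"
    "a 0 \<otimes> (a (k + 1) \<otimes> (a (2 * k) \<otimes> a (3 * k)))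
     = a 2 \<otimes> (a (k + 1) \<otimes> (a (2 * k + 2) \<otimes> a (3 * k + 2)))"
proof -
  show [simp]: "a i \<in> carrier G" for i by (simp add: a_def)
  have pp: "c [^] i \<otimes> c [^] j = c [^] (i + j)" for i j :: int
    by (simp add: int_pow_mult)
  have ppw: "c [^] i \<otimes> (c [^] j \<otimes> w) = c [^] (i + j) \<otimes> w" if "w \<in> carrier G" for i j :: int and w
    using that by (simp add: pp flip: m_assoc)
  have c1: "c = c [^] (1::int)" by (simp add: int_pow_1)
  have shift: "c [^] j \<otimes> a i = a (i + j) \<otimes> c [^] j" for i j
  proof -
    have "c [^] (- k - (i + j)) \<otimes> c [^] j = c [^] (- k - i)" by (simp add: pp)
    then have "a (i + j) \<otimes> c [^] j = c [^] (i + j) \<otimes> (x \<otimes> c [^] (- k - i))"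
      by (simp add: a_def m_assoc)
    also have "\<dots> = c [^] j \<otimes> a i" by (simp add: a_def ppw add.commute)
    finally show ?thesis by simp
  qed
  have shiftw: "c [^] j \<otimes> (a i \<otimes> w) = a (i + j) \<otimes> (c [^] j \<otimes> w)" if "w \<in> carrier G" for i j w
    using that shift[of j i] by (simp flip: m_assoc)
  show "a (i + 1) \<otimes> c = c \<otimes> a i" using shift[of 1 i] by (simp add: int_pow_1)
  have x: "x = a 0 \<otimes> c [^] k" by (simp add: a_def m_assoc pp)
  then show "a 0 \<otimes> c [^] k = x" by simp
  have "c [^] k \<otimes> c = c \<otimes> c [^] k"
    using pp[of k 1] pp[of 1 k] by (simp add: add.commute int_pow_1)
  then have "(a 1 \<otimes> c [^] k) \<otimes> c = (a 1 \<otimes> c) \<otimes> c [^] k" by (simp add: m_assoc)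
  also have "a 1 \<otimes> c = c \<otimes> a 0" using shift[of 1 0] by (simp add: int_pow_1)
  also have "c \<otimes> a 0 \<otimes> c [^] k = y \<otimes> c" unfolding yc by (simp add: m_assoc x[symmetric])
  finally have y: "y = a 1 \<otimes> c [^] k" by simp
  then show "a 1 \<otimes> c [^] k = y" by simp
  \<comment> \<open>Naming the exponent of the single \<open>c\<close> lets that factor be shifted
    to the right like the powers \<open>c [^] k\<close>.\<close>
  define d :: int where "d = 1"
  have cd: "c = c [^] d" by (simp add: d_def int_pow_1)
  have "x \<otimes> (y \<otimes> (x \<otimes> (x \<otimes> c [^] d))) =
      (a 0 \<otimes> (a (1 + k) \<otimes> (a (2 * k) \<otimes> a (3 * k)))) \<otimes> c [^] (4 * k + d)"
    unfolding x y by (simp add: m_assoc shiftw pp ppw add.assoc)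
  moreover have "c [^] d \<otimes> (y \<otimes> (x \<otimes> (y \<otimes> y))) =
      (a (1 + d) \<otimes> (a (k + d) \<otimes> (a (2 * k + 1 + d) \<otimes> a (3 * k + 1 + d)))) \<otimes> c [^] (4 * k + d)"
    unfolding x y by (simp add: m_assoc shiftw pp ppw add.assoc add.commute add.left_commute)
  ultimately show "a 0 \<otimes> (a (k + 1) \<otimes> (a (2 * k) \<otimes> a (3 * k)))
     = a 2 \<otimes> (a (k + 1) \<otimes> (a (2 * k + 2) \<otimes> a (3 * k + 2)))"
    using rel by (simp add: d_def int_pow_1 add.commute)
qed

text \<open>The rewritten relator has indices from \<open>0\<close> to \<open>3 * k + 2\<close>.
  Positivity of \<open>k\<close> keeps the two extremes apart from the other indices, so each can be
  solved for and \<open>3 * k + 2\<close> consecutive generators form a basis.\<close>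

locale fibre =
  fixes k n :: nat
  assumes k_pos: "k > 0" and n_def: "n = 3 * k + 2"
begin

abbreviation N where "N \<equiv> free_group {..<n}"

sublocale N: group N by (rule group_free_group)

definition g :: "nat \<Rightarrow> nat letter list" where
  "g i = [(True, i)]"

lemma g_closed [simp]: "i < n \<Longrightarrow> g i \<in> carrier N"
  by (simp add: g_def generator_in_free_group)

text \<open>
  \<open>up\<close> is \<open>a\<^sub>n\<close> as the relator expresses it in terms of \<open>a\<^sub>0, \<dots>, a\<^sub>n\<^sub>-\<^sub>1\<close>, and \<open>down\<close> is the
  same relator, shifted down by one and solved for the generator of index \<open>-1\<close>.
\<close>

definition up :: "nat letter list" where
  "up = inv\<^bsub>N\<^esub> (g 2 \<otimes>\<^bsub>N\<^esub> g (k + 1) \<otimes>\<^bsub>N\<^esub> g (2 * k + 2))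
    \<otimes>\<^bsub>N\<^esub> (g 0 \<otimes>\<^bsub>N\<^esub> g (k + 1) \<otimes>\<^bsub>N\<^esub> g (2 * k) \<otimes>\<^bsub>N\<^esub> g (3 * k))"

definition down :: "nat letter list" where
  "down = (g 1 \<otimes>\<^bsub>N\<^esub> g k \<otimes>\<^bsub>N\<^esub> g (2 * k + 1)) \<otimes>\<^bsub>N\<^esub> g (n - 1)
    \<otimes>\<^bsub>N\<^esub> inv\<^bsub>N\<^esub> (g k \<otimes>\<^bsub>N\<^esub> g (2 * k - 1) \<otimes>\<^bsub>N\<^esub> g (3 * k - 1))"

text \<open>This models conjugation by \<open>c\<close>, and \<tau> conjugation by its
  inverse.\<close>

definition \<sigma> :: "nat letter list \<Rightarrow> nat letter list" where
  "\<sigma> = free_eval N (\<lambda>i. if i + 1 < n then g (i + 1) else up)"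

definition \<tau> :: "nat letter list \<Rightarrow> nat letter list" where
  "\<tau> = free_eval N (\<lambda>i. if 0 < i then g (i - 1) else down)"

lemma indices:
  "0 < n" "1 < n" "2 < n" "k < n" "k + 1 < n" "2 * k < n" "2 * k + 1 < n" "2 * k + 2 < n" "3 * k < n"
  "n - 1 < n" "2 * k - 1 < n" "3 * k - 1 < n" "0 < 2 * k" "0 < 3 * k"
  using k_pos n_def by auto

lemma up_closed [simp]: "up \<in> carrier N"
  unfolding up_def using indices by simp

lemma down_closed [simp]: "down \<in> carrier N"
  unfolding down_def using indices by simp

lemma \<sigma>_hom: "\<sigma> \<in> hom N N"
  unfolding \<sigma>_def by (rule N.free_eval_hom) auto

lemma \<tau>_hom: "\<tau> \<in> hom N N"
  unfolding \<tau>_def by (rule N.free_eval_hom) auto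

sublocale \<sigma>: group_hom N N \<sigma>
  by (simp add: group_hom_def group_hom_axioms_def \<sigma>_hom)

sublocale \<tau>: group_hom N N \<tau>
  by (simp add: group_hom_def group_hom_axioms_def \<tau>_hom)

lemma \<sigma>_g: "i + 1 < n \<Longrightarrow> \<sigma> (g i) = g (i + 1)" "\<sigma> (g (n - 1)) = up"
proof -
  have "\<sigma> (g j) = (if j + 1 < n then g (j + 1) else up)" for j
    unfolding \<sigma>_def g_def[of j] by (rule N.free_eval_generator) simp
  then show "i + 1 < n \<Longrightarrow> \<sigma> (g i) = g (i + 1)" "\<sigma> (g (n - 1)) = up"
    using indices(1) by simp_all
qed

lemma \<tau>_g: "0 < i \<Longrightarrow> i < n \<Longrightarrow> \<tau> (g i) = g (i - 1)" "\<tau> (g 0) = down"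
proof -
  have "\<tau> (g j) = (if 0 < j then g (j - 1) else down)" if "j < n" for j
    unfolding \<tau>_def g_def[of j] by (subst N.free_eval_generator) (use that in auto)
  then show "0 < i \<Longrightarrow> i < n \<Longrightarrow> \<tau> (g i) = g (i - 1)" "\<tau> (g 0) = down"
    using indices by simp_all
qed

text \<open>Under \<tau> the factor \<open>g 0\<close> of \<open>up\<close> becomes
  \<open>down\<close>, whose trailing inverse cancels the factors after it.\<close>

lemma \<tau>_up: "\<tau> up = g (n - 1)"
proof -
  have "\<tau> up = inv\<^bsub>N\<^esub> (g 1 \<otimes>\<^bsub>N\<^esub> g k \<otimes>\<^bsub>N\<^esub> g (2 * k + 1))
    \<otimes>\<^bsub>N\<^esub> (down \<otimes>\<^bsub>N\<^esub> (g k \<otimes>\<^bsub>N\<^esub> g (2 * k - 1) \<otimes>\<^bsub>N\<^esub> g (3 * k - 1)))"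
    unfolding up_def using indices k_pos by (simp add: \<tau>_g N.m_assoc)
  also have "\<dots> = g (n - 1)"
    unfolding down_def using indices
    by (simp add: N.m_assoc N.inv_mult_group) (simp flip: N.m_assoc)
  finally show ?thesis .
qed

lemma \<sigma>_down: "\<sigma> down = g 0"
proof -
  \<comment> \<open>Subtraction is truncated; \<open>k_pos\<close> makes these genuine
    predecessors.\<close>
  have e: "2 * k - 1 + 1 = 2 * k" "3 * k - 1 + 1 = 3 * k" "1 + 1 = (2::nat)" "2 * k + 1 + 1 = 2 * k + 2"
    using k_pos by auto
  have "\<sigma> (g 1) = g 2" "\<sigma> (g k) = g (k + 1)" "\<sigma> (g (2 * k + 1)) = g (2 * k + 2)"
    "\<sigma> (g (2 * k - 1)) = g (2 * k)" "\<sigma> (g (3 * k - 1)) = g (3 * k)"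
    using k_pos n_def \<sigma>_g(1)[of 1] \<sigma>_g(1)[of k] \<sigma>_g(1)[of "2 * k + 1"]
      \<sigma>_g(1)[of "2 * k - 1"] \<sigma>_g(1)[of "3 * k - 1"] unfolding e by simp_all
  then have "\<sigma> down = (g 2 \<otimes>\<^bsub>N\<^esub> g (k + 1) \<otimes>\<^bsub>N\<^esub> g (2 * k + 2)) \<otimes>\<^bsub>N\<^esub> up
    \<otimes>\<^bsub>N\<^esub> inv\<^bsub>N\<^esub> (g (k + 1) \<otimes>\<^bsub>N\<^esub> g (2 * k) \<otimes>\<^bsub>N\<^esub> g (3 * k))"
    unfolding down_def using indices k_pos by (simp add: \<sigma>_g(2)[simplified])
  also have "\<dots> = g 0"
    unfolding up_def using indices
    by (simp add: N.m_assoc N.inv_mult_group) (simp flip: N.m_assoc)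
  finally show ?thesis .
qed

lemma \<tau>_\<sigma>: "w \<in> carrier N \<Longrightarrow> \<tau> (\<sigma> w) = w"
proof -
  assume w: "w \<in> carrier N"
  have "(\<tau> \<circ> \<sigma>) w = id w"
  proof (rule free_group_hom_eqI[OF N.is_group _ _ _ w])
    show "\<tau> \<circ> \<sigma> \<in> hom N N" using hom_compose[OF \<sigma>_hom \<tau>_hom] .
    fix i assume i: "i \<in> {..<n}"
    show "(\<tau> \<circ> \<sigma>) [(True, i)] = id [(True, i)]"
    proof (cases "i + 1 < n")
      case True
      then show ?thesis using \<sigma>_g(1)[OF True] \<tau>_g(1)[of "i + 1"] by (simp add: g_def)
    next
      case False
      then have "i = n - 1" using i by simp
      then show ?thesis using \<sigma>_g(2) \<tau>_up by (simp add: g_def)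
    qed
  qed (auto simp: hom_def)
  then show ?thesis by simp
qed

lemma \<sigma>_\<tau>: "w \<in> carrier N \<Longrightarrow> \<sigma> (\<tau> w) = w"
proof -
  assume w: "w \<in> carrier N"
  have "(\<sigma> \<circ> \<tau>) w = id w"
  proof (rule free_group_hom_eqI[OF N.is_group _ _ _ w])
    show "\<sigma> \<circ> \<tau> \<in> hom N N" using hom_compose[OF \<tau>_hom \<sigma>_hom] .
    fix i assume i: "i \<in> {..<n}"
    show "(\<sigma> \<circ> \<tau>) [(True, i)] = id [(True, i)]"
    proof (cases "0 < i")
      case True
      then show ?thesis using \<tau>_g(1)[OF True] \<sigma>_g(1)[of "i - 1"] i by (simp add: g_def)
    next
      case False
      then show ?thesis using \<tau>_g(2) \<sigma>_down by (simp add: g_def)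
    qed
  qed (auto simp: hom_def)
  then show ?thesis by simp
qed

definition shift :: "nat letter list \<Rightarrow> nat letter list" where
  "shift = restrict \<sigma> (carrier N)"

lemma shift_eq [simp]: "w \<in> carrier N \<Longrightarrow> shift w = \<sigma> w"
  by (simp add: shift_def)

sublocale cyclic_extension N shift
  using AutoGroupI[OF N.is_group \<sigma>_hom \<tau>_hom \<tau>_\<sigma> \<sigma>_\<tau>]
  by (simp add: cyclic_extension_def cyclic_extension_axioms_def shift_def)

lemma \<phi>_g: "i + j < n \<Longrightarrow> \<phi> (int j) (g i) = g (i + j)"
proof (induction j)
  case (Suc j)
  have "\<phi> (1 + int j) (g i) = \<sigma> (\<phi> (int j) (g i))"
    using \<phi>_add[of "g i" 1 "int j"] Suc.prems \<phi>_closed[of "g i" "int j"] by (simp add: \<phi>_1)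
  then show ?case using Suc \<sigma>_g(1)[of "i + j"] by (simp add: add.commute)
qed simp

text \<open>After \<open>n - 2\<close> shifts \<open>g 1\<close> is the last generator, and one more
  shift yields \<open>up\<close>. This evaluates the last \<open>y\<close> in the long
  relator.\<close>

lemma \<phi>_up: "\<phi> (int (n - 1)) (g 1) = up"
proof -
  have e: "1 + (n - 2) = n - 1" "1 + int (n - 2) = int (n - 1)" using n_def by auto
  have "\<phi> (1 + int (n - 2)) (g 1) = \<sigma> (\<phi> (int (n - 2)) (g 1))"
    using \<phi>_add[of "g 1" 1 "int (n - 2)"] indices(2) \<phi>_closed[of "g 1" "int (n - 2)"] by (simp add: \<phi>_1)
  moreover have "\<phi> (int (n - 2)) (g 1) = g (n - 1)"
    using \<phi>_g[of 1 "n - 2"] indices(10) unfolding e by blast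
  ultimately show ?thesis using \<sigma>_g(2) unfolding e by simp
qed

end

lemma finite_rung: "finite (UNIV :: rung set)"
proof -
  have "UNIV = {S0, S1, S2, S3}" using rung.exhaust by auto
  then show ?thesis by (metis finite.emptyI finite.insertI)
qed

abbreviation gen_x :: "(bool letter + rung letter) list" where "gen_x \<equiv> [Inl (True, False)]"
abbreviation gen_y :: "(bool letter + rung letter) list" where "gen_y \<equiv> [Inl (True, True)]"
abbreviation gen_t :: "(bool letter + rung letter) list" where "gen_t \<equiv> [Inr (True, S0)]"

section \<open>Isomorphism of the group with the extension\<close>

context fibre
begin

text \<open>The values are read off from \<open>x = a\<^sub>0 c\<^sup>k\<close>,
  \<open>y = a\<^sub>1 c\<^sup>k\<close> and \<open>t = c\<close>.\<close>

definition to_fibre :: "(bool letter + rung letter) list \<Rightarrow> nat letter list \<times> int" where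
  "to_fibre = R.word_eval E (gen_val E (g 0, int k) (g 1, int k) (\<one>\<^bsub>N\<^esub>, 1))"

lemma fibre_relations:
  "(g 1, int k) \<otimes>\<^bsub>E\<^esub> (\<one>\<^bsub>N\<^esub>, 1) = (\<one>\<^bsub>N\<^esub>, 1) \<otimes>\<^bsub>E\<^esub> (g 0, int k)"
  "(g 0, int k) \<otimes>\<^bsub>E\<^esub> ((g 1, int k) \<otimes>\<^bsub>E\<^esub> ((g 0, int k) \<otimes>\<^bsub>E\<^esub> ((g 0, int k) \<otimes>\<^bsub>E\<^esub> (\<one>\<^bsub>N\<^esub>, 1)))) =
    (\<one>\<^bsub>N\<^esub>, 1) \<otimes>\<^bsub>E\<^esub> ((g 1, int k) \<otimes>\<^bsub>E\<^esub> ((g 0, int k) \<otimes>\<^bsub>E\<^esub> ((g 1, int k) \<otimes>\<^bsub>E\<^esub> (g 1, int k))))"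
proof -
  note One_nat_def [simp del]
  have [simp]: "g 0 \<in> carrier N" "g 1 \<in> carrier N" using indices by simp_all
  have \<phi>1: "\<phi> 1 (g 0) = g 1" using \<phi>_g[of 0 1] indices by simp
  then show "(g 1, int k) \<otimes>\<^bsub>E\<^esub> (\<one>\<^bsub>N\<^esub>, 1) = (\<one>\<^bsub>N\<^esub>, 1) \<otimes>\<^bsub>E\<^esub> (g 0, int k)"
    by simp
  let ?K = "int k"
  have nest: "\<phi> i (\<phi> j (g 0)) = \<phi> (i + j) (g 0)" "\<phi> i (\<phi> j (g 1)) = \<phi> (i + j) (g 1)" for i j
    by (simp_all add: \<phi>_add)
  have \<phi>: "\<phi> ?K (g 1) = g (k + 1)" "\<phi> (2 * ?K) (g 0) = g (2 * k)" "\<phi> (3 * ?K) (g 0) = g (3 * k)"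
    "\<phi> 1 (g 1) = g 2" "\<phi> (1 + ?K) (g 0) = g (k + 1)" "\<phi> (1 + (2 * ?K)) (g 1) = g (2 * k + 2)"
    "\<phi> (1 + (3 * ?K)) (g 1) = up"
  proof -
    have shift: "\<phi> j (g i) = g m" if "j = int m - int i" "i \<le> m" "m < n" for i j m
      using \<phi>_g[of i "m - i"] that by (simp add: of_nat_diff)
    show "\<phi> ?K (g 1) = g (k + 1)" "\<phi> (2 * ?K) (g 0) = g (2 * k)" "\<phi> (3 * ?K) (g 0) = g (3 * k)"
      "\<phi> 1 (g 1) = g 2" "\<phi> (1 + ?K) (g 0) = g (k + 1)" "\<phi> (1 + (2 * ?K)) (g 1) = g (2 * k + 2)"
      by (rule shift; use indices in simp)+
    have "1 + (3 * ?K) = int (n - 1)" by (simp add: n_def)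
    then show "\<phi> (1 + (3 * ?K)) (g 1) = up" using \<phi>_up by simp
  qed
  \<comment> \<open>The relator with its last generator replaced by \<open>up\<close>, which was
    chosen to satisfy it.\<close>
  have "g 0 \<otimes>\<^bsub>N\<^esub> (g (k + 1) \<otimes>\<^bsub>N\<^esub> (g (2 * k) \<otimes>\<^bsub>N\<^esub> g (3 * k))) =
      g 2 \<otimes>\<^bsub>N\<^esub> (g (k + 1) \<otimes>\<^bsub>N\<^esub> (g (2 * k + 2) \<otimes>\<^bsub>N\<^esub> up))"
    unfolding up_def using indices
    by (simp add: N.m_assoc N.inv_mult_group) (simp flip: N.m_assoc)
  then show "(g 0, ?K) \<otimes>\<^bsub>E\<^esub> ((g 1, ?K) \<otimes>\<^bsub>E\<^esub> ((g 0, ?K) \<otimes>\<^bsub>E\<^esub> ((g 0, ?K) \<otimes>\<^bsub>E\<^esub> (\<one>\<^bsub>N\<^esub>, 1)))) =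
    (\<one>\<^bsub>N\<^esub>, 1) \<otimes>\<^bsub>E\<^esub> ((g 1, ?K) \<otimes>\<^bsub>E\<^esub> ((g 0, ?K) \<otimes>\<^bsub>E\<^esub> ((g 1, ?K) \<otimes>\<^bsub>E\<^esub> (g 1, ?K))))"
    by (simp add: \<phi>_mult nest) (simp add: \<phi>)
qed

lemma to_fibre_hom: "to_fibre \<in> hom R.word_group E"
  and to_fibre_single: "to_fibre [l] = gen_val E (g 0, int k) (g 1, int k) (\<one>\<^bsub>N\<^esub>, 1) l"
  unfolding to_fibre_def
  using E.gen_val_word_hom[OF _ _ _ fibre_relations] indices by simp_all

definition a :: "int \<Rightarrow> (bool letter + rung letter) list" where
  "a i = gen_t [^]\<^bsub>R.word_group\<^esub> i \<otimes>\<^bsub>R.word_group\<^esub> (gen_x \<otimes>\<^bsub>R.word_group\<^esub> gen_t [^]\<^bsub>R.word_group\<^esub> (- int k - i))"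

lemma a_relation:
  "a i \<in> carrier R.word_group"
  "a (i + 1) \<otimes>\<^bsub>R.word_group\<^esub> gen_t = gen_t \<otimes>\<^bsub>R.word_group\<^esub> a i"
  "a 0 \<otimes>\<^bsub>R.word_group\<^esub> gen_t [^]\<^bsub>R.word_group\<^esub> int k = gen_x" "a 1 \<otimes>\<^bsub>R.word_group\<^esub> gen_t [^]\<^bsub>R.word_group\<^esub> int k = gen_y"
  "a 0 \<otimes>\<^bsub>R.word_group\<^esub> (a (int k + 1) \<otimes>\<^bsub>R.word_group\<^esub> (a (2 * int k) \<otimes>\<^bsub>R.word_group\<^esub> a (3 * int k)))
    = a 2 \<otimes>\<^bsub>R.word_group\<^esub> (a (int k + 1) \<otimes>\<^bsub>R.word_group\<^esub> (a (2 * int k + 2) \<otimes>\<^bsub>R.word_group\<^esub> a (3 * int k + 2)))"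
proof -
  have c: "gen_x \<in> carrier R.word_group" "gen_y \<in> carrier R.word_group" "gen_t \<in> carrier R.word_group"
    by simp_all
  note r = R.Q.conj_relation[where k = "int k",
      OF c(1,3) gen_val_word_group(2) c(2) gen_val_word_group(3), folded a_def]
  show "a i \<in> carrier R.word_group" "a (i + 1) \<otimes>\<^bsub>R.word_group\<^esub> gen_t = gen_t \<otimes>\<^bsub>R.word_group\<^esub> a i"
    "a 0 \<otimes>\<^bsub>R.word_group\<^esub> gen_t [^]\<^bsub>R.word_group\<^esub> int k = gen_x" "a 1 \<otimes>\<^bsub>R.word_group\<^esub> gen_t [^]\<^bsub>R.word_group\<^esub> int k = gen_y"
    "a 0 \<otimes>\<^bsub>R.word_group\<^esub> (a (int k + 1) \<otimes>\<^bsub>R.word_group\<^esub> (a (2 * int k) \<otimes>\<^bsub>R.word_group\<^esub> a (3 * int k)))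
      = a 2 \<otimes>\<^bsub>R.word_group\<^esub> (a (int k + 1) \<otimes>\<^bsub>R.word_group\<^esub> (a (2 * int k + 2) \<otimes>\<^bsub>R.word_group\<^esub> a (3 * int k + 2)))"
    by (rule r)+
qed

definition from_free :: "nat letter list \<Rightarrow> (bool letter + rung letter) list" where
  "from_free = free_eval R.word_group (\<lambda>i. a (int i))"

definition from_fibre :: "nat letter list \<times> int \<Rightarrow> (bool letter + rung letter) list" where
  "from_fibre = (\<lambda>(w, j). from_free w \<otimes>\<^bsub>R.word_group\<^esub> gen_t [^]\<^bsub>R.word_group\<^esub> j)"

lemma from_free_hom: "from_free \<in> hom N R.word_group"
  unfolding from_free_def using a_relation(1) by (intro group.free_eval_hom[OF R.Q.is_group]) simp

sublocale from_free: group_hom N R.word_group from_free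
  by (simp add: group_hom_def group_hom_axioms_def from_free_hom R.Q.is_group N.is_group)

lemma from_free_g: "from_free (g i) = a (int i)"
  unfolding from_free_def g_def using a_relation(1) by (intro group.free_eval_generator[OF R.Q.is_group]) simp

text \<open>The relator holds for the elements \<open>a i\<close> of the group, so solving it for
  the last factor gives the value of \<open>up\<close>.\<close>

lemma from_free_up: "from_free up = a (int n)"
proof -
  have c: "a i \<in> carrier R.word_group" for i using a_relation(1) by simp
  have "from_free up = inv\<^bsub>R.word_group\<^esub> (a 2 \<otimes>\<^bsub>R.word_group\<^esub> a (int k + 1) \<otimes>\<^bsub>R.word_group\<^esub> a (2 * int k + 2))
      \<otimes>\<^bsub>R.word_group\<^esub> (a 0 \<otimes>\<^bsub>R.word_group\<^esub> (a (int k + 1) \<otimes>\<^bsub>R.word_group\<^esub> (a (2 * int k) \<otimes>\<^bsub>R.word_group\<^esub> a (3 * int k))))"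
    unfolding up_def using indices c
    by (simp add: from_free_g R.Q.m_assoc algebra_simps)
  also have "\<dots> = a (3 * int k + 2)"
    unfolding a_relation(5) using c
    by (simp add: R.Q.m_assoc R.Q.inv_mult_group del: R.carrier_word_group)
      (simp flip: R.Q.m_assoc del: R.carrier_word_group)
  also have "3 * int k + 2 = int n" by (simp add: n_def)
  finally show ?thesis .
qed

text \<open>The compatibility that \<open>hom_from_E\<close> asks for. With \<open>gen_t\<close>
  moved to one side, two homomorphisms are compared on generators; only the last generator needs the
  long relator.\<close>

lemma from_free_shift:
  assumes "w \<in> carrier N"
  shows "from_free (shift w) \<otimes>\<^bsub>R.word_group\<^esub> gen_t = gen_t \<otimes>\<^bsub>R.word_group\<^esub> from_free w"
proof -
  have c: "a i \<in> carrier R.word_group" "gen_t \<in> carrier R.word_group" for i using a_relation(1) by simp_all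
  have "(from_free \<circ> \<sigma>) w = gen_t \<otimes>\<^bsub>R.word_group\<^esub> from_free w \<otimes>\<^bsub>R.word_group\<^esub> inv\<^bsub>R.word_group\<^esub> gen_t"
  proof (rule free_group_hom_eqI[OF R.Q.is_group _ _ _ assms])
    show "from_free \<circ> \<sigma> \<in> hom N R.word_group" using hom_compose[OF \<sigma>_hom from_free_hom] .
    show "(\<lambda>w. gen_t \<otimes>\<^bsub>R.word_group\<^esub> from_free w \<otimes>\<^bsub>R.word_group\<^esub> inv\<^bsub>R.word_group\<^esub> gen_t) \<in> hom N R.word_group"
      using c(2) from_free.hom_closed
      by (intro homI) (simp_all add: R.Q.m_assoc del: R.carrier_word_group R.qinv_single R.one_word_group,
        simp flip: R.Q.m_assoc del: R.carrier_word_group R.qinv_single R.one_word_group)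
    fix i assume i: "i \<in> {..<n}"
    have "from_free (\<sigma> (g i)) = a (int i + 1)"
    proof (cases "i + 1 < n")
      case True
      then show ?thesis by (simp add: \<sigma>_g(1) from_free_g add.commute)
    next
      case False
      then have "i = n - 1" "int i + 1 = int n" using i by auto
      then show ?thesis using \<sigma>_g(2) from_free_up by simp
    qed
    also have "\<dots> = gen_t \<otimes>\<^bsub>R.word_group\<^esub> a (int i) \<otimes>\<^bsub>R.word_group\<^esub> inv\<^bsub>R.word_group\<^esub> gen_t"
      unfolding a_relation(2)[symmetric] using c
      by (simp add: R.Q.m_assoc del: R.carrier_word_group R.qinv_single R.one_word_group)
    finally show "(from_free \<circ> \<sigma>) [(True, i)] = gen_t \<otimes>\<^bsub>R.word_group\<^esub> from_free [(True, i)] \<otimes>\<^bsub>R.word_group\<^esub> inv\<^bsub>R.word_group\<^esub> gen_t"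
      using from_free_g[of i] by (simp add: g_def)
  qed
  then show ?thesis
    using assms c(2) by (simp add: R.Q.m_assoc del: R.carrier_word_group R.qinv_single R.one_word_group)
qed

lemma from_fibre_hom: "from_fibre \<in> hom E R.word_group"
  unfolding from_fibre_def using from_free_shift
  by (intro hom_from_E R.Q.is_group from_free_hom) auto

sublocale to_fibre: group_hom R.word_group E to_fibre
  by (simp add: group_hom_def group_hom_axioms_def to_fibre_hom R.Q.is_group E.is_group)

lemma to_fibre_pow: "to_fibre (gen_t [^]\<^bsub>R.word_group\<^esub> j) = (\<one>\<^bsub>N\<^esub>, j)"
  using to_fibre.hom_int_pow[of gen_t j] pow_E[of j] by (simp add: to_fibre_single)

lemma to_fibre_from_free:
  assumes "w \<in> carrier N"
  shows "to_fibre (from_free w) = (w, 0)"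
proof -
  have "(to_fibre \<circ> from_free) w = (w, 0)"
  proof (rule free_group_hom_eqI[OF E.is_group _ _ _ assms])
    show "to_fibre \<circ> from_free \<in> hom N E" using hom_compose[OF from_free_hom to_fibre_hom] .
    show "(\<lambda>w. (w, 0)) \<in> hom N E" by (intro homI) auto
    fix i assume i: "i \<in> {..<n}"
    have c: "gen_x \<in> carrier R.word_group" "gen_t \<in> carrier R.word_group" by simp_all
    have "to_fibre (a (int i)) = (\<one>\<^bsub>N\<^esub>, int i) \<otimes>\<^bsub>E\<^esub> ((g 0, int k) \<otimes>\<^bsub>E\<^esub> (\<one>\<^bsub>N\<^esub>, - int k - int i))"
      unfolding a_def using c by (simp add: to_fibre_pow to_fibre_single del: mult_E R.carrier_word_group)
    \<comment> \<open>The exponents of \<open>c\<close> cancel, and shifting \<open>g 0\<close> by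
      \<open>i\<close> gives \<open>g i\<close>.\<close>
    also have "\<dots> = (g i, 0)"
      using i indices \<phi>_g[of 0 i] by simp
    finally show "(to_fibre \<circ> from_free) [(True, i)] = ([(True, i)], 0)"
      using from_free_g[of i] by (simp add: g_def)
  qed
  then show ?thesis by simp
qed

lemma to_fibre_from_fibre:
  assumes "p \<in> carrier E"
  shows "to_fibre (from_fibre p) = p"
proof -
  obtain w j where p: "p = (w, j)" "w \<in> carrier N" using assms by (cases p) auto
  have "gen_t [^]\<^bsub>R.word_group\<^esub> j \<in> carrier R.word_group"
    by (rule R.Q.int_pow_closed) simp
  then show ?thesis
    using p from_free.hom_closed[of w]
    by (simp add: from_fibre_def to_fibre_from_free to_fibre_pow del: R.carrier_word_group)
qed

text \<open>Every letter is built from \<open>x\<close>, \<open>y\<close>, \<open>t\<close> by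
  \<open>gen_val\<close>, which commutes with homomorphisms, so it suffices that these three are
  fixed.\<close>

lemma from_fibre_to_fibre:
  assumes "R.nf w"
  shows "from_fibre (to_fibre w) = w"
proof -
  have "(from_fibre \<circ> to_fibre) w = id w"
  proof (rule R.word_group_hom_eqI[OF R.Q.is_group _ _ _ assms])
    show "from_fibre \<circ> to_fibre \<in> hom R.word_group R.word_group"
      using hom_compose[OF to_fibre_hom from_fibre_hom] .
    fix l
    have "from_fibre (g 0, int k) = gen_x" "from_fibre (g 1, int k) = gen_y" "from_fibre (\<one>\<^bsub>N\<^esub>, 1) = gen_t"
      using a_relation(3,4) from_free_g[of 0] from_free_g[of 1] from_free.hom_one
      by (simp_all add: from_fibre_def R.Q.int_pow_1)
    then show "(from_fibre \<circ> to_fibre) [l] = id [l]"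
      using gen_val_hom[OF E.is_group R.Q.is_group from_fibre_hom, of "(g 0, int k)" "(g 1, int k)" "(\<one>\<^bsub>N\<^esub>, 1)" l]
        indices by (simp add: to_fibre_single gen_val_word_group(1))
  qed (auto simp: hom_def)
  then show ?thesis by simp
qed

lemma word_group_is_free_by_Z: "is_free_by_Z R.word_group n"
proof -
  have "bij_betw to_fibre (carrier R.word_group) (carrier E)"
    using to_fibre_from_fibre from_fibre_to_fibre to_fibre_hom from_fibre_hom
    by (intro bij_betwI[where g = from_fibre]) (auto simp: hom_def)
  then have "R.word_group \<cong> E"
    using to_fibre_hom unfolding is_iso_def iso_def by blast
  then show ?thesis
    unfolding is_free_by_Z_def using \<phi>_hom by blast
qed

end

section \<open>Epimorphisms onto the integers and conclusion\<close>

lemma infinite_epimorphisms_word_group: "infinite (epimorphisms R.word_group integer_group)"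
proof -
  \<comment> \<open>Both relators hold in the integers for \<open>x = y = k\<close> and
    \<open>t = 1\<close>: the sides of the long one sum to \<open>4 * k + 1\<close>. The value at
    \<open>t\<close> gives surjectivity, the value at \<open>x\<close> distinguishes the
    maps.\<close>
  let ?f = "\<lambda>k. R.word_eval integer_group (gen_val integer_group k k 1)"
  let ?r = "\<lambda>k. restrict (?f k) (carrier R.word_group)"
  have hom: "?f k \<in> hom R.word_group integer_group" and
    single: "?f k [l] = gen_val integer_group k k 1 l" for k l
    using group.gen_val_word_hom[OF group_integer_group, of k k 1] by simp_all
  have "?r k \<in> epimorphisms R.word_group integer_group" for k
  proof -
    interpret f: group_hom R.word_group integer_group "?f k"
      by (simp add: group_hom_def group_hom_axioms_def hom R.Q.is_group)
    have "?r k \<in> hom R.word_group integer_group"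
      using hom[of k] R.Q.is_monoid by (auto simp: hom_def Pi_def)
    moreover have "j \<in> ?r k ` carrier R.word_group" for j :: int
    proof (rule image_eqI)
      let ?w = "[Inr (True, S0)] [^]\<^bsub>R.word_group\<^esub> j"
      show "?w \<in> carrier R.word_group" by (rule R.Q.int_pow_closed) simp
      then show "j = ?r k ?w"
        using f.hom_int_pow[of "[Inr (True, S0)]" j] single[of k "Inr (True, S0)"] by simp
    qed
    ultimately show ?thesis by (auto simp: epimorphisms_def epi_def)
  qed
  then have "range ?r \<subseteq> epimorphisms R.word_group integer_group" by blast
  moreover have "inj ?r"
  proof (rule injI)
    fix k m :: int assume "?r k = ?r m"
    then have "?r k [Inl (True, False)] = ?r m [Inl (True, False)]" by simp
    then show "k = m" using single[of k "Inl (True, False)"] single[of m "Inl (True, False)"] by simp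
  qed
  ultimately show ?thesis
    using infinite_UNIV_int finite_imageD finite_subset by blast
qed

theorem theorem1p1:
  shows "\<exists>G :: (nat letter list \<times> int) monoid.
           group G \<and> hyperbolic_group G \<and> free_by_cyclic G \<and>
           infinite (epimorphisms G integer_group) \<and>
           infinite {n :: nat. n > 0 \<and> is_free_by_Z G n}"
proof -
  have fbz: "is_free_by_Z R.word_group (3 * k + 2)" if "k > 0" for k
    using fibre.word_group_is_free_by_Z[of k "3 * k + 2"] that by (simp add: fibre_def)
  \<comment> \<open>The carrier type asked for is that of a semidirect product, so \<open>G\<close>
    is the model for \<open>k = 1\<close>, of rank 5; all properties are transported to it.\<close>
  obtain \<phi> where \<phi>: "\<phi> \<in> hom integer_group (AutoGroup (free_group {..<5::nat}))"
    and iso: "R.word_group \<cong> semidirect_product (free_group {..<5::nat}) integer_group \<phi>"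
    using fbz[of 1] by (auto simp: is_free_by_Z_def)
  define G where "G = semidirect_product (free_group {..<5::nat}) integer_group \<phi>"
  have G: "group G"
    unfolding G_def by (rule group_semidirect_product[OF group_free_group group_integer_group \<phi>])
  have iso': "G \<cong> R.word_group"
    using group.iso_sym[OF R.Q.is_group iso] by (simp add: G_def)
  have "hyperbolic_group R.word_group"
    by (rule R.hyperbolic_word_group) (simp_all add: finite_rung)
  then have "hyperbolic_group G"
    using hyperbolic_group_iso[OF _ G] iso by (simp add: G_def)
  moreover have fbzG: "is_free_by_Z G (3 * k + 2)" if "k > 0" for k
    by (rule is_free_by_Z_iso[OF iso' fbz[OF that]])
  moreover have "infinite {n :: nat. n > 0 \<and> is_free_by_Z G n}"
  proof -
    have "range (\<lambda>k. 3 * Suc k + 2) \<subseteq> {n :: nat. n > 0 \<and> is_free_by_Z G n}"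
      by (intro image_subsetI CollectI conjI fbzG) simp_all
    moreover have "infinite (range (\<lambda>k::nat. 3 * Suc k + 2))"
      by (rule range_inj_infinite) (simp add: inj_def)
    ultimately show ?thesis using infinite_super by blast
  qed
  moreover have "infinite (epimorphisms G integer_group)"
    by (rule infinite_epimorphisms_iso[OF G iso' infinite_epimorphisms_word_group])
  moreover have "free_by_cyclic G"
    unfolding free_by_cyclic_def using fbzG[OF zero_less_one] by (rule exI)
  ultimately show ?thesis
    using G by blast
qed

end
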